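(* Let $\lambda\ge1$. There exists a constant $C_1(\lambda)$ such that, for any $k\ge1$ and any $P\in\mathcal{H}_k$, $$\|P\|_\infty\le C_1(\lambda)\,k^{\lambda+1/2}\,\|P\|_2 .$$
   Context: Deltoid domain: let $D\subset\mathbb{R}^2\simeq\mathbb{C}$ be the bounded open domain containing $0$ whose boundary is the deltoid curve $t\mapsto \frac13(2e^{it}+e^{-2it})$; write $Z=x+iy$. For $\lambda>0$, $\mu^{(\lambda)}$ is the probability measure on $D$ with density $C_\alpha P_0^{\alpha}$ with respect to Lebesgue measure, where $P_0(Z,\bar Z)=\frac14(1-Z\bar Z)^2-(\bar Z-Z^2)(Z-\bar Z^2)$ (positive in $D$), $\alpha=\frac{2\lambda-5}{6}$, and $C_\alpha$ is the normalizing constant. It is the reversible measure of the deltoid operator $$L^{(\lambda)}f=(\bar Z-Z^2)\,\partial_Z^2 f+(1-Z\bar Z)\,\partial_Z\partial_{\bar Z}f+(Z-\bar Z^2)\,\partial_{\bar Z}^2f-\lambda\,(Z\partial_Z f+\bar Z\partial_{\bar Z} f).$$ Let $\mathcal{P}_k$ be the space of polynomials in $(x,y)$ of total degree at most $k$, restricted to $D$; $\mathcal{H}_0$ is the space of constants, and for $k\ge1$, $\mathcal{H}_k$ is the subspace of $\mathcal{P}_k$ orthogonal to $\mathcal{P}_{k-1}$ in $L^2(\mu^{(\lambda)})$. Here $\|\cdot\|_2$ is the norm of $L^2(\mu^{(\lambda)})$ and $\|\cdot\|_\infty$ is the supremum norm on $D$. *)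

theory Defs
  imports "HOL-Analysis.Analysis"
begin

definition deltoid_curve :: "real \<Rightarrow> complex" where
  "deltoid_curve t = (2 * exp (\<i> * of_real t) + exp (- 2 * \<i> * of_real t)) / 3"

definition deltoid_domain :: "complex set" where
  "deltoid_domain = connected_component_set (- range deltoid_curve) 0"

text \<open>The only candidate for a domain that contains the origin and is bounded by the
  deltoid curve is the component above.\<close>

lemma deltoid_domain_unique:
  assumes "open D" "connected D" "0 \<in> D" "frontier D = range deltoid_curve"
  shows "D = deltoid_domain"
proof -
  have "D \<inter> frontier D = {}"
    using assms(1) by (auto simp: frontier_def interior_open)
  then have sub: "D \<subseteq> deltoid_domain"
    unfolding deltoid_domain_def using assms
    by (intro connected_component_maximal) auto
  have "deltoid_domain \<subseteq> - range deltoid_curve"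
    unfolding deltoid_domain_def by (rule connected_component_subset)
  then have "deltoid_domain \<inter> frontier D = {}"
    using assms(4) by blast
  moreover have "connected deltoid_domain"
    unfolding deltoid_domain_def by (rule connected_connected_component)
  moreover have "deltoid_domain \<inter> D \<noteq> {}"
    using sub assms(3) by blast
  ultimately have "deltoid_domain \<subseteq> D"
    using connected_Int_frontier by blast
  with sub show ?thesis by blast
qed

text \<open>Taking the real part loses nothing, see the lemma below.\<close>

definition deltoid_P0 :: "complex \<Rightarrow> real" where
  "deltoid_P0 Z = Re (1 / 4 * (1 - Z * cnj Z)\<^sup>2 - (cnj Z - Z\<^sup>2) * (Z - (cnj Z)\<^sup>2))"

lemma of_real_deltoid_P0:
  "of_real (deltoid_P0 Z) = 1 / 4 * (1 - Z * cnj Z)\<^sup>2 - (cnj Z - Z\<^sup>2) * (Z - (cnj Z)\<^sup>2)"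
proof -
  have "cnj (1 / 4 * (1 - Z * cnj Z)\<^sup>2 - (cnj Z - Z\<^sup>2) * (Z - (cnj Z)\<^sup>2))
      = 1 / 4 * (1 - Z * cnj Z)\<^sup>2 - (cnj Z - Z\<^sup>2) * (Z - (cnj Z)\<^sup>2)"
    by (simp add: mult.commute)
  then show ?thesis
    unfolding deltoid_P0_def by (metis Reals_cnj_iff of_real_Re)
qed

definition deltoid_alpha :: "real \<Rightarrow> real" where
  "deltoid_alpha lam = (2 * lam - 5) / 6"

definition deltoid_const :: "real \<Rightarrow> real" where
  "deltoid_const lam =
    1 / (LINT Z:deltoid_domain|lborel. deltoid_P0 Z powr deltoid_alpha lam)"

definition deltoid_measure :: "real \<Rightarrow> complex measure" where
  "deltoid_measure lam = density (restrict_space lborel deltoid_domain)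
    (\<lambda>Z. ennreal (deltoid_const lam * deltoid_P0 Z powr deltoid_alpha lam))"

text \<open>Polynomials in the real coordinates $(x,y)$ have complex coefficients here. They are kept
  as functions on the whole plane: since the domain is open and nonempty, restriction to it is
  injective on polynomials, and the inner product and both norms below only see the restriction.\<close>

definition poly_space :: "nat \<Rightarrow> (complex \<Rightarrow> complex) set" where
  "poly_space k = {p. \<exists>c :: nat \<Rightarrow> nat \<Rightarrow> complex. \<forall>Z.
    p Z = (\<Sum>i\<le>k. \<Sum>j\<le>k - i. c i j * of_real (Re Z) ^ i * of_real (Im Z) ^ j)}"

definition deltoid_inner :: "real \<Rightarrow> (complex \<Rightarrow> complex) \<Rightarrow> (complex \<Rightarrow> complex) \<Rightarrow> complex" where
  "deltoid_inner lam f g = (LINT Z|deltoid_measure lam. f Z * cnj (g Z))"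

definition deltoid_H :: "real \<Rightarrow> nat \<Rightarrow> (complex \<Rightarrow> complex) set" where
  "deltoid_H lam k =
    (if k = 0 then {p. \<exists>c. p = (\<lambda>_. c)}
     else {p \<in> poly_space k. \<forall>q \<in> poly_space (k - 1). deltoid_inner lam p q = 0})"

definition deltoid_norm2 :: "real \<Rightarrow> (complex \<Rightarrow> complex) \<Rightarrow> real" where
  "deltoid_norm2 lam f = sqrt (LINT Z|deltoid_measure lam. (cmod (f Z))\<^sup>2)"

definition deltoid_norm_sup :: "(complex \<Rightarrow> complex) \<Rightarrow> ereal" where
  "deltoid_norm_sup f = (SUP Z \<in> deltoid_domain. ereal (cmod (f Z)))"

end

theory Submission
  imports Defs "HOL-Complex_Analysis.Conformal_Mappings"
begin

text \<open>
  The deltoid domain is the injective image of an open triangle (the Weyl alcove of type $A_2$)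
  under $(s, u) \mapsto \frac13 (e^{i(s+u)} + e^{i(s-u)} + e^{-2is})$. In these coordinates
  $P_0 = \frac{4}{27} h^2$ and the Jacobian is $\frac49 h$ for one function $h$, a product of three
  sines, so that $P_0^\alpha$ times Lebesgue measure becomes a multiple of
  $h^{2(\lambda-1)/3}\, ds\, du$. A polynomial of degree $k$ pulls back to a trigonometric
  polynomial of degree $O(k)$ that is bounded on the whole plane by its maximum $M$ over the closed
  triangle. By Bernstein's inequality it is at least $M/2$ in absolute value within distance of
  order $1/k$ of a maximum point; there the triangle contains a square of side of order $1/k$ on
  which $h$ is at least of order $k^{-3}$. Hence
  $\|P\|_2^2 \ge c\, M^2 k^{-2} k^{-2(\lambda-1)} = c\, M^2 k^{-2\lambda}$. This holds for all
  polynomials of degree at most $k$, and with exponent $\lambda$ in place of $\lambda + 1/2$.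
\<close>

section \<open>Alcove coordinates on the deltoid domain\<close>

text \<open>For fixed \<open>s\<close> the parameter \<open>u\<close> runs along a tangent segment of the deltoid.\<close>

definition deltoid_param :: "real \<Rightarrow> real \<Rightarrow> complex" where
  "deltoid_param s u = (cis (s + u) + cis (s - u) + cis (- 2 * s)) / 3"

definition alcove :: "(real \<times> real) set" where
  "alcove = {(s, u). 0 < u \<and> u < 3 * s \<and> u + 3 * s < 2 * pi}"

definition closed_alcove :: "(real \<times> real) set" where
  "closed_alcove = {(s, u). 0 \<le> u \<and> u \<le> 3 * s \<and> u + 3 * s \<le> 2 * pi}"

text \<open>Up to a constant this is the Vandermonde product of the three unit numbers summed in
  \<^const>\<open>deltoid_param\<close>, that is, a square root of the discriminant of the cubic with these roots.\<close>

definition half_discr :: "real \<Rightarrow> real \<Rightarrow> real" where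
  "half_discr s u = sin u * (cos u - cos (3 * s))"

text \<open>One sine factor for each side of the alcove: inside, all three arguments lie strictly
  between 0 and pi, and on a side one of them reaches 0 or pi.\<close>

lemma half_discr_eq: "half_discr s u = 2 * sin u * sin ((3 * s + u) / 2) * sin ((3 * s - u) / 2)"
proof -
  have "cos u - cos (3 * s) = 2 * sin ((u + 3 * s) / 2) * sin ((3 * s - u) / 2)"
    by (rule cos_diff_cos)
  then show ?thesis by (simp add: half_discr_def add.commute)
qed

lemma half_discr_pos: "(s, u) \<in> alcove \<Longrightarrow> 0 < half_discr s u"
  unfolding half_discr_eq alcove_def
  by (intro mult_pos_pos sin_gt_zero) auto

lemma deltoid_param_Re: "Re (deltoid_param s u) = (2 * cos s * cos u + cos (2 * s)) / 3"
  and deltoid_param_Im: "Im (deltoid_param s u) = (2 * sin s * cos u - sin (2 * s)) / 3"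
  by (simp_all add: deltoid_param_def cos_add cos_diff sin_add sin_diff)

lemma deltoid_param_eq: "deltoid_param s u = (2 * of_real (cos u) * cis s + (cis (- s))\<^sup>2) / 3"
proof -
  have "cis (s + u) + cis (s - u) = 2 * of_real (cos u) * cis s"
    by (simp add: complex_eq_iff cos_add cos_diff sin_add sin_diff)
  moreover have "cis (- 2 * s) = (cis (- s))\<^sup>2"
    by (simp add: power2_eq_square cis_mult)
  ultimately show ?thesis by (simp only: deltoid_param_def)
qed

text \<open>Up to a constant factor, \<open>deltoid_P0 Z\<close> is the discriminant of the cubic
  T^3 - 3 Z T^2 + 3 (cnj Z) T - 1, whose roots are the three unit numbers. The proof computes
  directly: with \<open>w * v = 1\<close>, both sides become polynomials in \<open>c\<close> = cos u
  and \<open>q\<close> = 2 cos (3 s).\<close>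

lemma deltoid_P0_param: "deltoid_P0 (deltoid_param s u) = 4 / 27 * (half_discr s u)\<^sup>2"
proof -
  define c S w v where "c = complex_of_real (cos u)" and "S = complex_of_real (sin u)"
    and "w = cis s" and "v = cis (- s)"
  have wv: "w * v = 1" by (simp add: w_def v_def cis_mult)
  have cS: "c\<^sup>2 + S\<^sup>2 = 1"
    unfolding c_def S_def by (metis of_real_1 of_real_add of_real_power sin_cos_squared_add2)
  have Z: "deltoid_param s u = (2 * c * w + v\<^sup>2) / 3"
    and Z': "cnj (deltoid_param s u) = (2 * c * v + w\<^sup>2) / 3"
    by (simp_all add: deltoid_param_eq c_def w_def v_def cis_cnj)
  have h: "complex_of_real (half_discr s u) = S * (c - (w ^ 3 + v ^ 3) / 2)"
  proof -
    have "w ^ 3 + v ^ 3 = 2 * of_real (cos (3 * s))"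
      unfolding w_def v_def Complex.DeMoivre by (simp add: complex_eq_iff)
    then show ?thesis by (simp add: half_discr_def S_def c_def)
  qed
  have S2: "(S * (c - (w ^ 3 + v ^ 3) / 2))\<^sup>2 = (1 - c\<^sup>2) * (c - (w ^ 3 + v ^ 3) / 2)\<^sup>2"
    by (simp add: power_mult_distrib flip: cS)
  define q where "q = w ^ 3 + v ^ 3"
  define X Y where "X = deltoid_param s u" and "Y = cnj X"
  note XY = Z [folded X_def] Z' [folded X_def Y_def]
  \<comment> \<open>The powers of \<open>w * v\<close> stay visible, so that the identity holds for
    free variables; \<open>w * v = 1\<close> is substituted afterwards. The product of the two
    differences below is treated in the same way.\<close>
  have "(2 * c * w + v\<^sup>2) * (2 * c * v + w\<^sup>2)
      = 4 * c\<^sup>2 * (w * v) + 2 * c * q + (w * v)\<^sup>2"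
    unfolding q_def by algebra
  then have e1: "X * Y = (4 * c\<^sup>2 + 2 * c * q + 1) / 9"
    unfolding XY by (simp add: wv)
  have third: "a / 3 - (b / 3)\<^sup>2 = (3 * a - b\<^sup>2) / 9" for a b :: complex
    by (simp add: power2_eq_square field_simps)
  have "3 * (2 * c * v + w\<^sup>2) - (2 * c * w + v\<^sup>2)\<^sup>2
      = 2 * c * v + (3 - 4 * c\<^sup>2) * w\<^sup>2 - v ^ 4"
    using wv by algebra
  then have e2: "Y - X\<^sup>2 = (2 * c * v + (3 - 4 * c\<^sup>2) * w\<^sup>2 - v ^ 4) / 9"
    unfolding XY third by (simp only:)
  have "3 * (2 * c * w + v\<^sup>2) - (2 * c * v + w\<^sup>2)\<^sup>2
      = 2 * c * w + (3 - 4 * c\<^sup>2) * v\<^sup>2 - w ^ 4"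
    using wv by algebra
  then have e3: "X - Y\<^sup>2 = (2 * c * w + (3 - 4 * c\<^sup>2) * v\<^sup>2 - w ^ 4) / 9"
    unfolding XY third by (simp only:)
  have "(2 * c * v + (3 - 4 * c\<^sup>2) * w\<^sup>2 - v ^ 4) * (2 * c * w + (3 - 4 * c\<^sup>2) * v\<^sup>2 - w ^ 4)
      = 4 * c\<^sup>2 * (w * v) + 2 * c * (3 - 4 * c\<^sup>2) * q - 2 * c * (w * v) * q
        + (3 - 4 * c\<^sup>2)\<^sup>2 * (w * v)\<^sup>2 - (3 - 4 * c\<^sup>2) * (q\<^sup>2 - 2 * (w * v) ^ 3) + (w * v) ^ 4"
    unfolding q_def by algebra
  then have e4: "(Y - X\<^sup>2) * (X - Y\<^sup>2) = (4 * c\<^sup>2 + 2 * c * (3 - 4 * c\<^sup>2) * q - 2 * c * q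
        + (3 - 4 * c\<^sup>2)\<^sup>2 - (3 - 4 * c\<^sup>2) * (q\<^sup>2 - 2) + 1) / 81"
    unfolding e2 e3 by (simp add: wv)
  have "1 / 4 * (1 - X * Y)\<^sup>2 - (Y - X\<^sup>2) * (X - Y\<^sup>2) = 4 / 27 * ((1 - c\<^sup>2) * (c - q / 2)\<^sup>2)"
    unfolding e4 e1 by algebra
  also have "(1 - c\<^sup>2) * (c - q / 2)\<^sup>2 = (of_real (half_discr s u))\<^sup>2"
    using S2 unfolding h q_def by simp
  finally have "complex_of_real (deltoid_P0 (deltoid_param s u)) = of_real (4 / 27 * (half_discr s u)\<^sup>2)"
    unfolding of_real_deltoid_P0 X_def Y_def by simp
  then show ?thesis by (simp only: of_real_eq_iff)
qed

section \<open>Injectivity of the parametrization on the open triangle\<close>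

text \<open>The inverse of a unit number is its conjugate, so when the product is 1 the second
  elementary symmetric function is the conjugate of the first. The sum alone thus determines the
  cubic, and with it the set of roots.\<close>

lemma sym_cubic_of_sum:
  fixes A B C w :: complex
  assumes "cmod A = 1" "cmod B = 1" "cmod C = 1" "A * B * C = 1"
  shows "(w - A) * (w - B) * (w - C)
    = w ^ 3 - (A + B + C) * w\<^sup>2 + cnj (A + B + C) * w - 1"
proof -
  have n: "A * cnj A = 1" "B * cnj B = 1" "C * cnj C = 1"
    using assms by (simp_all add: complex_norm_square [symmetric])
  have "A * B + B * C + A * C = cnj A + cnj B + cnj C"
    using n assms(4) by algebra
  then have "cnj (A + B + C) = A * B + B * C + A * C" by simp
  then show ?thesis using assms(4)
    by (simp only:) (simp add: algebra_simps power2_eq_square power3_eq_cube)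
qed

lemma cis_eq_close:
  assumes "cis x = cis y" "- 2 * pi < x - y" "x - y < 2 * pi" shows "x = y"
proof -
  have "cis (x - y) = 1" using assms(1) by (simp flip: cis_divide)
  then have "cos (x - y) = 1" by (simp add: complex_eq_iff)
  then obtain n :: int where n: "x - y = of_int n * 2 * pi"
    using cos_one_2pi_int by auto
  have "(- 1) * (2 * pi) < real_of_int n * (2 * pi)" "real_of_int n * (2 * pi) < 1 * (2 * pi)"
    using assms(2,3) n by (simp_all add: mult_ac)
  then have "- 1 < real_of_int n" "real_of_int n < 1"
    by (simp_all only: mult_less_cancel_right_pos pi_gt_zero zero_less_mult_iff zero_less_numeral simp_thms)
  then have "n = 0" by linarith
  with n show ?thesis by simp
qed

lemma cis_eq_shift:
  assumes "cis x = cis y" "0 < x - y" "x - y < 4 * pi" shows "x = y + 2 * pi"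
  using cis_eq_close [of x "y + 2 * pi"] assms by (simp flip: cis_mult)

text \<open>The value determines the three unit numbers as a set, namely as the roots of a cubic;
  in the alcove their arguments are ordered, sum to zero and spread over less than a full turn,
  which leaves no freedom for a permutation.\<close>

lemma deltoid_param_inj: "inj_on (\<lambda>(s, u). deltoid_param s u) alcove"
proof (clarsimp simp: inj_on_def)
  fix s u s' u' assume T: "(s, u) \<in> alcove" "(s', u') \<in> alcove"
    and eq: "deltoid_param s u = deltoid_param s' u'"
  define a b c where "a = s + u" and "b = s - u" and "c = - 2 * s"
  define a' b' c' where "a' = s' + u'" and "b' = s' - u'" and "c' = - 2 * s'"
  note d = a_def b_def c_def a'_def b'_def c'_def
  have ord: "c < b" "b < a" "a < c + 2 * pi" "a + b + c = 0"
    "c' < b'" "b' < a'" "a' < c' + 2 * pi" "a' + b' + c' = 0"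
    using T by (auto simp: alcove_def d)
  have e: "cis a + cis b + cis c = cis a' + cis b' + cis c'"
    using eq unfolding deltoid_param_def d by (simp only: divide_cancel_right) simp
  \<comment> \<open>Equal sums give equal cubics, so every root on one side is a root on the
    other.\<close>
  have "(cis t - cis a) * (cis t - cis b) * (cis t - cis c)
      = (cis t - cis a') * (cis t - cis b') * (cis t - cis c')" for t
    by (subst (1 2) sym_cubic_of_sum) (use ord in \<open>auto simp: cis_mult e simp del: complex_cnj_add\<close>)
  then have root: "cis t = cis a' \<or> cis t = cis b' \<or> cis t = cis c'" if "t = a \<or> t = c" for t
    using that by (metis eq_iff_diff_eq_0 mult_eq_0_iff)
  have ac: "cis a \<noteq> cis c" using cis_eq_close [of a c] ord by linarith
  \<comment> \<open>\<open>c\<close> and \<open>c'\<close> are the smallest arguments. If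
    \<open>c\<close> were matched with \<open>a'\<close> or \<open>b'\<close>, each possible partner
    of \<open>a\<close> would contradict the ordering. Then \<open>c\<close> fixes \<open>s\<close>,
    and \<open>cos u\<close> fixes \<open>u\<close> in (0, pi).\<close>
  have "c = c'"
  proof -
    consider "cis c = cis a'" | "cis c = cis b'" | "cis c = cis c'" using root by blast
    then show ?thesis
    proof cases
      case 1
      then have c: "a' = c + 2 * pi" using cis_eq_shift [OF 1 [symmetric]] ord by linarith
      consider "cis a = cis b'" | "cis a = cis c'" using root [of a] 1 ac by metis
      then show ?thesis
      proof cases
        case 1
        then have "a = b'" using cis_eq_close [of a b'] ord by linarith
        then show ?thesis using c ord by linarith
      next
        case 2
        then have "a = c' + 2 * pi" using cis_eq_shift [of a c'] ord by linarith
        then show ?thesis using c ord by linarith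
      qed
    next
      case 2
      then have c: "c = b'" using cis_eq_close [of c b'] ord by linarith
      consider "cis a = cis a'" | "cis a = cis c'" using root [of a] 2 ac by metis
      then show ?thesis
      proof cases
        case 1
        then have "a = a'" using cis_eq_close [of a a'] ord by linarith
        then show ?thesis using c ord by linarith
      next
        case 2
        then have "a = c' + 2 * pi" using cis_eq_shift [of a c'] ord by linarith
        then show ?thesis using c ord by linarith
      qed
    next
      case 3
      then show ?thesis using cis_eq_close [of c c'] ord by linarith
    qed
  qed
  then have s: "s = s'" by (simp add: d)
  have "cis s * (2 * of_real (cos u)) = cis s * (2 * of_real (cos u'))"
    using eq unfolding deltoid_param_eq s by simp
  then have "cos u = cos u'" by simp
  then have "u = u'" using T by (auto simp: alcove_def intro: cos_inj_pi)
  with s show "s = s' \<and> u = u'" by simp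
qed

section \<open>Folding the parameter plane onto the closed triangle\<close>

text \<open>The sum lies in [0, 6 pi), so \<open>n\<close> is 0, 1 or 2. Lowering the
  \<open>n\<close> largest arguments by 2 pi makes the sum zero and keeps the spread within a full
  turn, which describes the closed alcove.\<close>

lemma deltoid_param_fold_sorted:
  assumes "0 \<le> x" "x \<le> y" "y \<le> z" "z < 2 * pi" "x + y + z = of_int n * (2 * pi)"
  shows "\<exists>(s, u) \<in> closed_alcove. cis x + cis y + cis z = 3 * deltoid_param s u"
proof -
  \<comment> \<open>Mean and half difference of the two larger arguments serve as \<open>s\<close>
    and \<open>u\<close>; the zero sum makes the third one \<open>- 2 * s\<close>.\<close>
  have fold: "\<exists>(s, u) \<in> closed_alcove. cis a + cis b + cis c = 3 * deltoid_param s u"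
    if "c \<le> b" "b \<le> a" "a \<le> c + 2 * pi" "a + b + c = 0" for a b c
  proof (intro bexI [of _ "((a + b) / 2, (a - b) / 2)"])
    have "- 2 * ((a + b) / 2) = c" "(a + b) / 2 + (a - b) / 2 = a" "(a + b) / 2 - (a - b) / 2 = b"
      using that by (simp_all add: field_simps)
    then show "case ((a + b) / 2, (a - b) / 2) of (s, u) \<Rightarrow> cis a + cis b + cis c = 3 * deltoid_param s u"
      by (simp only: deltoid_param_def prod.case) simp
  qed (use that in \<open>auto simp: closed_alcove_def field_simps\<close>)
  have "0 \<le> of_int n * (2 * pi)" "of_int n * (2 * pi) < 3 * (2 * pi)"
    using assms by linarith+
  then have "0 \<le> real_of_int n" "real_of_int n < 3"
    by (simp_all only: mult_less_cancel_right_pos zero_le_mult_iff pi_gt_zero zero_less_mult_iff zero_less_numeral simp_thms)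
       (use pi_gt_zero in linarith)
  then consider "n = 0" | "n = 1" | "n = 2" by linarith
  then show ?thesis
  proof cases
    case 1
    then show ?thesis using fold [of z y x] assms by (simp add: add_ac)
  next
    case 2
    then show ?thesis using fold [of "z - 2 * pi" x y] assms
      by (simp add: add_ac flip: cis_divide)
  next
    case 3
    then show ?thesis using fold [of "y - 2 * pi" "z - 2 * pi" x] assms
      by (simp add: add_ac flip: cis_divide)
  qed
qed

text \<open>This carries a bound on the closed triangle over to the whole plane, where Bernstein's
  inequality requires it. The arguments \<open>s + u\<close>, \<open>s - u\<close>,
  \<open>- 2 * s\<close> sum to zero, so their residues modulo 2 pi sum to a multiple of 2 pi; the
  six orderings reduce to the sorted case.\<close>

lemma deltoid_param_fold: "\<exists>(s', u') \<in> closed_alcove. deltoid_param s u = deltoid_param s' u'"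
proof -
  define r where "r t = t - of_int \<lfloor>t / (2 * pi)\<rfloor> * (2 * pi)" for t
  have cis_r: "cis (r t) = cis t" for t
    using cis_multiple_2pi [of "of_int \<lfloor>t / (2 * pi)\<rfloor>"]
    unfolding r_def by (simp flip: cis_divide add: mult_ac)
  have r0: "0 \<le> r t" and r1: "r t < 2 * pi" for t
    using floor_divide_lower [of "2 * pi" t] floor_divide_upper [of "2 * pi" t] pi_gt_zero
    by (auto simp: r_def algebra_simps)
  define x y z where "x = r (s + u)" and "y = r (s - u)" and "z = r (- 2 * s)"
  have xyz: "0 \<le> x" "0 \<le> y" "0 \<le> z" "x < 2 * pi" "y < 2 * pi" "z < 2 * pi"
    by (simp_all add: x_def y_def z_def r0 r1)
  have p: "deltoid_param s u = (cis x + cis y + cis z) / 3"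
    by (simp add: x_def y_def z_def deltoid_param_def cis_r)
  have "x + y + z = of_int (- \<lfloor>(s + u) / (2 * pi)\<rfloor> - \<lfloor>(s - u) / (2 * pi)\<rfloor>
      - \<lfloor>(- 2 * s) / (2 * pi)\<rfloor>) * (2 * pi)"
    unfolding x_def y_def z_def r_def by (simp add: algebra_simps)
  then obtain n where n: "x + y + z = of_int n * (2 * pi)" by blast
  have "\<exists>(s, u) \<in> closed_alcove. cis x + cis y + cis z = 3 * deltoid_param s u"
    using deltoid_param_fold_sorted [of x y z n] deltoid_param_fold_sorted [of x z y n]
      deltoid_param_fold_sorted [of y x z n] deltoid_param_fold_sorted [of y z x n]
      deltoid_param_fold_sorted [of z x y n] deltoid_param_fold_sorted [of z y x n] n xyz
    by (simp add: add_ac) (metis linorder_linear)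
  then show ?thesis by (force simp: p)
qed

section \<open>The image of the triangle is the deltoid domain\<close>

abbreviation param :: "real \<times> real \<Rightarrow> complex" where
  "param \<equiv> \<lambda>(s, u). deltoid_param s u"

lemma deltoid_curve_param: "deltoid_curve t = deltoid_param t 0"
  by (simp add: deltoid_curve_def deltoid_param_def cis_conv_exp mult_ac)

text \<open>On each side of the triangle two of the three unit numbers coincide; the argument of the
  double one is the parameter of the point on the curve.\<close>

lemma param_boundary_in_curve:
  assumes "p \<in> closed_alcove" "p \<notin> alcove" shows "param p \<in> range deltoid_curve"
proof -
  obtain s u where p: "p = (s, u)" by fastforce
  consider "u = 0" | "u = 3 * s" | "u = 2 * pi - 3 * s"
    using assms unfolding p by (auto simp: closed_alcove_def alcove_def)
  then have "\<exists>t. deltoid_param s u = deltoid_param t 0"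
  proof cases
    case 1 then show ?thesis by blast
  next
    case 2
    have "deltoid_param s u = deltoid_param (- 2 * s) 0"
      unfolding deltoid_param_def 2 by (simp add: algebra_simps)
    then show ?thesis ..
  next
    case 3
    have "cis (s - u) = cis (4 * s) * cis (- (2 * pi))"
      unfolding 3 by (simp only: cis_mult) (simp add: algebra_simps)
    moreover have "cis (s + u) = cis (- 2 * s) * cis (2 * pi)"
      unfolding 3 by (simp only: cis_mult) (simp add: algebra_simps)
    ultimately have "deltoid_param s u = deltoid_param (- 2 * s) 0"
      unfolding deltoid_param_def by (simp flip: cis_cnj)
    then show ?thesis ..
  qed
  then show ?thesis by (auto simp: p deltoid_curve_param)
qed

lemma continuous_on_param: "continuous_on S param"
  unfolding deltoid_param_def case_prod_beta by (intro continuous_intros) simp_all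

lemma closed_alcove_inter: "closed_alcove = {p. 0 \<le> snd p} \<inter> {p. snd p \<le> 3 * fst p} \<inter> {p. snd p + 3 * fst p \<le> 2 * pi}"
  and alcove_inter: "alcove = {p. 0 < snd p} \<inter> {p. snd p < 3 * fst p} \<inter> {p. snd p + 3 * fst p < 2 * pi}"
  by (auto simp: closed_alcove_def alcove_def)

lemma compact_closed_alcove: "compact closed_alcove"
proof -
  have "closed closed_alcove"
    unfolding closed_alcove_inter by (intro closed_Int closed_Collect_le continuous_intros)
  then have "compact (cbox (0, 0) (pi, 2 * pi) \<inter> closed_alcove)"
    by (intro compact_Int_closed compact_cbox)
  moreover have "closed_alcove = cbox (0, 0) (pi, 2 * pi) \<inter> closed_alcove"
    by (auto simp: closed_alcove_def cbox_Pair_eq)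
  ultimately show ?thesis by (simp only:)
qed

lemma open_alcove: "open alcove"
  unfolding alcove_inter by (intro open_Int open_Collect_less continuous_intros)

lemma convex_alcove: "convex alcove"
proof -
  have 1: "{p. 0 < snd p} = {p :: real \<times> real. (0, - 1) \<bullet> p < 0}"
    and 2: "{p. snd p < 3 * fst p} = {p :: real \<times> real. (- 3, 1) \<bullet> p < 0}"
    and 3: "{p. snd p + 3 * fst p < 2 * pi} = {p :: real \<times> real. (3, 1) \<bullet> p < 2 * pi}"
    by (auto simp: inner_prod_def)
  show ?thesis
    unfolding alcove_inter 1 2 3 by (intro convex_Int convex_halfspace_lt)
qed

lemma open_param_alcove: "open (param ` alcove)"
  by (rule invariance_of_domain_gen)
     (use open_alcove continuous_on_param deltoid_param_inj in \<open>simp_all\<close>)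

text \<open>The image is connected, contains 0 and misses the curve, because
  \<open>deltoid_P0\<close> is positive on it and vanishes on the curve. Conversely, a connected set
  around 0 that left the image would meet its frontier, which lies on the curve.\<close>

lemma deltoid_domain_eq: "deltoid_domain = param ` alcove"
proof
  have "deltoid_P0 z = 0" if "z \<in> range deltoid_curve" for z
    using that by (auto simp: deltoid_curve_param deltoid_P0_param half_discr_def)
  moreover have "deltoid_P0 z > 0" if "z \<in> param ` alcove" for z
    using that half_discr_pos by (force simp: deltoid_P0_param)
  ultimately have disj: "param ` alcove \<subseteq> - range deltoid_curve" by fastforce
  \<comment> \<open>At this point the three unit numbers are the cube roots of unity.\<close>
  have "param (pi / 3, pi / 3) = 0"
    by (simp add: deltoid_param_def complex_eq_iff cos_120 cos_60 sin_60 flip: cos_double)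
  moreover have "(pi / 3, pi / 3) \<in> alcove" by (simp add: alcove_def)
  ultimately have 0: "0 \<in> param ` alcove" by force
  have "connected (param ` alcove)"
    by (intro connected_continuous_image continuous_on_param convex_connected convex_alcove)
  then show "param ` alcove \<subseteq> deltoid_domain"
    unfolding deltoid_domain_def by (intro connected_component_maximal 0 disj)
  have fr: "frontier (param ` alcove) \<subseteq> range deltoid_curve"
  proof -
    have "compact (param ` closed_alcove)"
      by (intro compact_continuous_image continuous_on_param compact_closed_alcove)
    then have "closure (param ` alcove) \<subseteq> param ` closed_alcove"
      by (intro closure_minimal image_mono compact_imp_closed) (auto simp: alcove_def closed_alcove_def)
    then show ?thesis
      unfolding frontier_def interior_open [OF open_param_alcove]
      using param_boundary_in_curve by blast
  qed
  show "deltoid_domain \<subseteq> param ` alcove"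
  proof (rule ccontr)
    assume "\<not> deltoid_domain \<subseteq> param ` alcove"
    moreover have "0 \<in> deltoid_domain"
      unfolding deltoid_domain_def using 0 disj by (auto simp: connected_component_refl_eq)
    moreover have "connected deltoid_domain"
      unfolding deltoid_domain_def by (rule connected_connected_component)
    ultimately have "deltoid_domain \<inter> frontier (param ` alcove) \<noteq> {}"
      using 0 by (intro connected_Int_frontier) blast+
    moreover have "deltoid_domain \<subseteq> - range deltoid_curve"
      unfolding deltoid_domain_def by (rule connected_component_subset)
    ultimately show False using fr by blast
  qed
qed

section \<open>Bernstein's inequality\<close>

text \<open>Inside the disc this is the maximum modulus principle. Outside, the principle is applied
  to the reversed polynomial z^n q(1/z), which obeys the same bound on the unit circle.\<close>

lemma poly_bound_outside_circle:
  fixes q :: "complex poly"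
  assumes deg: "degree q \<le> n" and M: "\<And>z. cmod z = 1 \<Longrightarrow> cmod (poly q z) \<le> M"
  shows "cmod (poly q w) \<le> M * max 1 (cmod w) ^ n"
proof (cases "cmod w \<le> 1")
  case True
  have "cmod (poly q w) \<le> M"
    by (rule maximum_modulus_frontier [of "poly q" "cball 0 1"])
       (use True M in \<open>auto intro!: holomorphic_intros continuous_intros\<close>)
  then show ?thesis using True by simp
next
  case False
  \<comment> \<open>The monomial factor turns the reversal at the actual degree into a reversal at
    \<open>n\<close>.\<close>
  define r where "r = monom 1 (n - degree q) * reflect_poly q"
  have r: "poly r z = z ^ n * poly q (inverse z)" if "z \<noteq> 0" for z
    using deg that by (simp add: r_def poly_reflect_poly_nz poly_monom flip: power_add mult.assoc)
  have "cmod (poly r (inverse w)) \<le> M"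
  proof (rule maximum_modulus_frontier [of "poly r" "cball 0 1"])
    fix z :: complex assume "z \<in> frontier (cball 0 1)"
    then have z: "cmod z = 1" by simp
    then have "z \<noteq> 0" by auto
    with z show "cmod (poly r z) \<le> M"
      using M [of "inverse z"] by (simp add: r norm_mult norm_power norm_inverse)
  qed (use False in \<open>auto intro!: holomorphic_intros continuous_intros simp: norm_inverse inverse_le_1_iff\<close>)
  moreover have "w \<noteq> 0" using False by auto
  ultimately have "cmod (poly q w) / cmod w ^ n \<le> M"
    by (simp add: r norm_mult norm_power norm_inverse power_inverse divide_inverse mult.commute)
  then show ?thesis
    using False \<open>w \<noteq> 0\<close> by (simp add: field_simps)
qed

text \<open>Bernstein's inequality with a constant that is not sharp: Cauchy's estimate on the
  circle of radius 1/n about \<open>z\<close>, where \<open>q\<close> has grown by at most (1 +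
  1/n)^n \<le> e \<le> 3.\<close>

lemma pderiv_bound_circle:
  fixes q :: "complex poly"
  assumes deg: "degree q \<le> n" and "n > 0" and M: "\<And>z. cmod z = 1 \<Longrightarrow> cmod (poly q z) \<le> M"
    and z: "cmod z = 1"
  shows "cmod (poly (pderiv q) z) \<le> 3 * real n * M"
proof -
  have M0: "0 \<le> M" using M [of 1] norm_ge_zero [of "poly q 1"] by (simp del: norm_ge_zero)
  have "cmod ((deriv ^^ 1) (poly q) z) \<le> fact 1 * (3 * M) / (1 / real n) ^ 1"
  proof (rule Cauchy_inequality)
    fix w assume w: "cmod (z - w) = 1 / real n"
    have "cmod w \<le> cmod z + cmod (z - w)"
      by (metis norm_triangle_sub norm_minus_commute)
    then have "max 1 (cmod w) \<le> 1 + 1 / real n"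
      using w z by simp
    then have "max 1 (cmod w) ^ n \<le> (1 + 1 / real n) ^ n"
      by (intro power_mono) auto
    also have "\<dots> \<le> exp 1"
      using exp_ge_one_plus_x_over_n_power_n [of n 1] \<open>n > 0\<close> by simp
    also have "\<dots> \<le> 3" by (rule exp_le)
    finally show "cmod (poly q w) \<le> 3 * M"
      using poly_bound_outside_circle [OF deg M, of w] mult_left_mono [OF _ M0] by fastforce
  qed (use \<open>n > 0\<close> in \<open>auto intro!: holomorphic_intros continuous_intros\<close>)
  moreover have "deriv (poly q) z = poly (pderiv q) z"
    by (rule DERIV_imp_deriv) (rule poly_DERIV)
  ultimately show ?thesis by (simp add: mult_ac)
qed

section \<open>Trigonometric polynomials\<close>

text \<open>Frequencies from -N to N, encoded as a polynomial in e^(it) shifted by -N, so that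
  bounds for polynomials on the unit circle apply.\<close>

definition trig_poly :: "nat \<Rightarrow> (real \<Rightarrow> complex) \<Rightarrow> bool" where
  "trig_poly N f \<longleftrightarrow>
     (\<exists>q. degree q \<le> 2 * N \<and> (\<forall>t. f t = cis (- (real N * t)) * poly q (cis t)))"

lemma trig_poly_const: "trig_poly 0 (\<lambda>t. c)"
  unfolding trig_poly_def by (rule exI [of _ "[:c:]"]) auto

lemma trig_poly_mult:
  assumes "trig_poly N f" "trig_poly K g" shows "trig_poly (N + K) (\<lambda>t. f t * g t)"
proof -
  from assms obtain p q
    where p: "degree p \<le> 2 * N" "\<And>t. f t = cis (- (real N * t)) * poly p (cis t)"
      and q: "degree q \<le> 2 * K" "\<And>t. g t = cis (- (real K * t)) * poly q (cis t)"
    unfolding trig_poly_def by blast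
  have "f t * g t = cis (- (real (N + K) * t)) * poly (p * q) (cis t)" for t
  proof -
    have "cis (- (real N * t)) * cis (- (real K * t)) = cis (- (real (N + K) * t))"
      by (simp add: cis_mult algebra_simps)
    then show ?thesis unfolding p q poly_mult by (metis (no_types) mult.assoc mult.commute)
  qed
  moreover have "degree (p * q) \<le> 2 * (N + K)"
    using p(1) q(1) degree_mult_le [of p q] by simp
  ultimately show ?thesis unfolding trig_poly_def by blast
qed

lemma trig_poly_add:
  assumes "trig_poly N f" "trig_poly N g" shows "trig_poly N (\<lambda>t. f t + g t)"
proof -
  from assms obtain p q where "degree p \<le> 2 * N" "\<And>t. f t = cis (- (real N * t)) * poly p (cis t)"
    "degree q \<le> 2 * N" "\<And>t. g t = cis (- (real N * t)) * poly q (cis t)"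
    unfolding trig_poly_def by blast
  then show ?thesis unfolding trig_poly_def
    by (intro exI [of _ "p + q"]) (auto simp: distrib_left intro: degree_add_le)
qed

lemma trig_poly_mono:
  assumes f: "trig_poly N f" and "N \<le> K" shows "trig_poly K f"
proof -
  from f obtain p where p: "degree p \<le> 2 * N" "\<And>t. f t = cis (- (real N * t)) * poly p (cis t)"
    unfolding trig_poly_def by blast
  have "degree (monom 1 (K - N) * p) \<le> (K - N) + 2 * N"
    using p(1) by (intro order_trans [OF degree_mult_le] add_mono) (auto simp: degree_monom_le)
  then have "degree (monom 1 (K - N) * p) \<le> 2 * K" using \<open>N \<le> K\<close> by simp
  moreover have "f t = cis (- (real K * t)) * poly (monom 1 (K - N) * p) (cis t)" for t
  proof -
    obtain d where "K = N + d" using \<open>N \<le> K\<close> by (metis le_iff_add)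
    then have "cis (- (real K * t)) * cis t ^ (K - N) = cis (- (real N * t))"
      unfolding Complex.DeMoivre cis_mult by (simp add: distrib_right)
    then show ?thesis by (simp add: p(2) poly_monom flip: mult.assoc)
  qed
  ultimately show ?thesis unfolding trig_poly_def by blast
qed

lemma trig_poly_sum:
  assumes "\<And>i. i \<in> I \<Longrightarrow> trig_poly N (f i)" shows "trig_poly N (\<lambda>t. \<Sum>i\<in>I. f i t)"
  using assms
proof (induction I rule: infinite_finite_induct)
  case (insert i I)
  then show ?case by (simp add: trig_poly_add)
qed (auto intro: trig_poly_mono [OF trig_poly_const])

lemma trig_poly_power:
  assumes "trig_poly N f" shows "trig_poly (N * n) (\<lambda>t. f t ^ n)"
proof (induction n)
  case (Suc n)
  from trig_poly_mult [OF assms this] show ?case by simp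
qed (simp add: trig_poly_const)

lemma trig_poly_cos: "trig_poly 1 (\<lambda>t. of_real (cos t))"
  unfolding trig_poly_def
proof (intro exI [of _ "[:1/2, 0, 1/2:]"] conjI allI)
  fix t
  have "cis (- (real 1 * t)) * poly [:1/2, 0, 1/2:] (cis t)
      = (cis (- t) + cis (- t) * cis t * cis t) / 2"
    by (simp add: algebra_simps)
  then show "of_real (cos t) = cis (- (real 1 * t)) * poly [:1/2, 0, 1/2:] (cis t)"
    by (simp add: cis_mult complex_eq_iff)
qed auto

lemma trig_poly_sin: "trig_poly 1 (\<lambda>t. of_real (sin t))"
  unfolding trig_poly_def
proof (intro exI [of _ "[:\<i>/2, 0, -\<i>/2:]"] conjI allI)
  fix t
  have "cis (- (real 1 * t)) * poly [:\<i>/2, 0, -\<i>/2:] (cis t)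
      = \<i> * (cis (- t) - cis (- t) * cis t * cis t) / 2"
    by (simp add: algebra_simps)
  then show "of_real (sin t) = cis (- (real 1 * t)) * poly [:\<i>/2, 0, -\<i>/2:] (cis t)"
    by (simp add: cis_mult complex_eq_iff)
qed auto

text \<open>The derivative is bounded by \<open>7 * real N * M\<close>: one part comes from the
  factor \<open>cis (- (real N * t))\<close>, and 3 * 2 parts come from the derivative of
  \<open>q\<close>, whose degree is at most \<open>2 * N\<close>.\<close>

lemma trig_poly_lipschitz:
  assumes f: "trig_poly N f" and M: "\<And>t. cmod (f t) \<le> M" and N: "N > 0"
  shows "cmod (f s - f t) \<le> 7 * real N * M * \<bar>s - t\<bar>"
proof -
  from f obtain q where q: "degree q \<le> 2 * N" "\<And>t. f t = cis (- (real N * t)) * poly q (cis t)"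
    unfolding trig_poly_def by blast
  have qM: "cmod (poly q z) \<le> M" if "cmod z = 1" for z
  proof -
    obtain t where "z = cis t" using \<open>cmod z = 1\<close> by (metis complex_norm_eq_1_exp cis_conv_exp)
    then show ?thesis using M [of t] q(2) [of t] by (simp add: norm_mult)
  qed
  define f' where "f' = (\<lambda>t. - (\<i> * of_real (real N)) * f t
    + cis (- (real N * t)) * (poly (pderiv q) (cis t) * (\<i> * cis t)))"
  have "(f has_vector_derivative f' t) (at t)" for t
  proof -
    have *: "(cis has_vector_derivative \<i> * cis t) (at t)" for t
      unfolding has_vector_derivative_complex_iff
      by (auto intro!: derivative_eq_intros simp flip: has_real_derivative_iff_has_vector_derivative)
    have 1: "((\<lambda>t. cis (- (real N * t))) has_vector_derivative
        (- real N) *\<^sub>R (\<i> * cis (- (real N * t)))) (at t)"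
      using vector_diff_chain_at [OF _ *, of "\<lambda>t. - (real N * t)" "- real N" t]
      by (force simp: o_def intro: derivative_eq_intros)
    have 2: "((\<lambda>t. poly q (cis t)) has_vector_derivative (\<i> * cis t) * poly (pderiv q) (cis t)) (at t)"
      using field_vector_diff_chain_at [OF * poly_DERIV [of q "cis t"]] by (simp add: o_def)
    show ?thesis
      using has_vector_derivative_mult [OF 1 2]
      by (simp add: q(2) [abs_def] f'_def scaleR_conv_of_real algebra_simps)
  qed
  moreover have "cmod (f' t) \<le> 7 * real N * M" for t
  proof -
    have "cmod (f' t) \<le> real N * cmod (f t) + cmod (poly (pderiv q) (cis t))"
      unfolding f'_def by (rule norm_triangle_le) (simp add: norm_mult)
    also have "\<dots> \<le> real N * M + 3 * real (2 * N) * M"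
      by (intro add_mono mult_left_mono M pderiv_bound_circle q qM) (use N in auto)
    finally show ?thesis by (simp add: algebra_simps)
  qed
  ultimately have "norm (f s - f t) \<le> (7 * real N * M) * norm (s - t)"
    unfolding has_vector_derivative_def
    by (intro differentiable_bound [where S = UNIV and f' = "\<lambda>t h. h *\<^sub>R f' t"])
       (auto intro!: onorm_le simp: mult.commute [of "\<bar>_\<bar>"] mult_right_mono)
  then show ?thesis by simp
qed

section \<open>The weighted measure in alcove coordinates\<close>

lemma Basis_vec2: "(Basis :: (real^2) set) = {axis 1 1, axis 2 1}"
  by (auto simp: Basis_vec_def UNIV_2)

text \<open>Serves to move integrals over \<open>real \<times> real\<close> and over
  \<open>complex\<close> to \<open>real^2\<close>. The coordinate map pulls boxes back to boxes of
  the same volume, and this characterizes Lebesgue measure.\<close>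

lemma lborel_distr_vec2:
  fixes b c :: "'a::euclidean_space"
  assumes B: "Basis = {b, c}" and "b \<noteq> c"
  shows "distr lborel borel (\<lambda>v :: real^2. v $ 1 *\<^sub>R b + v $ 2 *\<^sub>R c) = lborel"
proof (rule lborel_eqI [symmetric])
  let ?e = "\<lambda>v :: real^2. v $ 1 *\<^sub>R b + v $ 2 *\<^sub>R c"
  have [simp]: "b \<bullet> b = 1" "c \<bullet> c = 1" "b \<bullet> c = 0" "c \<bullet> b = 0"
    using B \<open>b \<noteq> c\<close> by (auto intro: inner_Basis [THEN trans])
  fix l u :: 'a assume le: "\<And>x. x \<in> Basis \<Longrightarrow> l \<bullet> x \<le> u \<bullet> x"
  let ?vec = "\<lambda>l. vector [l \<bullet> b, l \<bullet> c] :: real^2"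
  have "?e -` box l u = box (?vec l) (?vec u)"
    by (auto simp: box_def B Basis_vec2 inner_axis inner_add_left)
  moreover have "?e \<in> borel_measurable lborel"
    by (simp add: borel_measurable_continuous_onI continuous_intros)
  ultimately have "emeasure (distr lborel borel ?e) (box l u) = emeasure lborel (box (?vec l) (?vec u))"
    by (subst emeasure_distr) auto
  also have "\<dots> = (\<Prod>x\<in>Basis. (u - l) \<bullet> x)"
    using le by (simp add: emeasure_lborel_box_eq Basis_vec2 inner_axis B \<open>b \<noteq> c\<close> axis_eq_axis inner_diff_left)
  finally show "emeasure (distr lborel borel ?e) (box l u) = (\<Prod>x\<in>Basis. (u - l) \<bullet> x)" .
qed simp

text \<open>Links the Lebesgue integral of a Borel function to the form in which the substitution
  theorem on \<open>real^2\<close> speaks of it: absolute integrability with values in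
  \<open>real^1\<close>.\<close>

lemma set_lborel_iff_vec1:
  fixes h :: "'a::euclidean_space \<Rightarrow> real"
  assumes S: "S \<in> sets borel" and h: "h \<in> borel_measurable borel"
  shows "set_integrable lborel S h \<and> (LINT x:S|lborel. h x) = b \<longleftrightarrow>
    (\<lambda>x. vec (h x) :: real^1) absolutely_integrable_on S
      \<and> integral S (\<lambda>x. vec (h x) :: real^1) = vec b"
proof -
  have "h absolutely_integrable_on S \<longleftrightarrow> set_integrable lborel S h"
    unfolding set_integrable_def
    by (rule integrable_completion) (use assms in measurable)
  moreover have "(LINT x:S|lborel. h x) = integral S h" if "set_integrable lborel S h"
    using that by (rule set_borel_integral_eq_integral)
  ultimately show ?thesis
    by (auto simp: absolutely_integrable_on_1_iff integral_on_1_eq vec_eq_iff)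
qed

lemma set_lborel_distr:
  fixes e :: "'a::euclidean_space \<Rightarrow> 'b::euclidean_space" and f :: "'b \<Rightarrow> real"
  assumes d: "distr lborel borel e = lborel" and e: "e \<in> borel_measurable borel"
    and S: "S \<in> sets borel" and f: "f \<in> borel_measurable borel"
  shows "set_integrable lborel S f \<and> (LINT z:S|lborel. f z) = b \<longleftrightarrow>
    set_integrable lborel (e -` S) (\<lambda>v. f (e v)) \<and> (LINT v:e -` S|lborel. f (e v)) = b"
proof -
  have m: "(\<lambda>z. indicator S z *\<^sub>R f z) \<in> borel_measurable borel"
    using S f by measurable
  have e': "e \<in> lborel \<rightarrow>\<^sub>M borel" using e by simp
  show ?thesis
    unfolding set_integrable_def set_lebesgue_integral_def
    using integrable_distr_eq [OF e' m] integral_distr [OF e' m]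
    by (simp add: d indicator_vimage)
qed

text \<open>With the coordinate maps \<open>e\<close> and \<open>r\<close>, the map \<open>g\<close>
  becomes \<open>h\<close> = r o g o e on \<open>real^2\<close>, with the same Jacobian.
  Integrability and value form one equivalence, so either side yields both for the other.\<close>

lemma change_of_variables_2:
  fixes g :: "real \<times> real \<Rightarrow> complex" and f :: "complex \<Rightarrow> real"
    and Dg :: "real \<times> real \<Rightarrow> real \<times> real \<Rightarrow> complex"
  assumes S: "S \<in> sets borel" and gS: "g ` S \<in> sets borel" and inj: "inj_on g S"
    and der: "\<And>x. x \<in> S \<Longrightarrow> (g has_derivative Dg x) (at x)"
    and J: "\<And>x. x \<in> S \<Longrightarrow> \<bar>Re (Dg x (1, 0)) * Im (Dg x (0, 1)) - Re (Dg x (0, 1)) * Im (Dg x (1, 0))\<bar> = J x"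
    and f: "f \<in> borel_measurable borel" and m: "(\<lambda>x. J x * f (g x)) \<in> borel_measurable borel"
  shows "set_integrable lborel (g ` S) f \<and> (LINT z:g ` S|lborel. f z) = b \<longleftrightarrow>
    set_integrable lborel S (\<lambda>x. J x * f (g x)) \<and> (LINT x:S|lborel. J x * f (g x)) = b"
proof -
  define e where "e = (\<lambda>v :: real^2. (v $ 1, v $ 2))"
  define r where "r = (\<lambda>z. Re z *\<^sub>R axis 1 1 + Im z *\<^sub>R axis 2 1 :: real^2)"
  define r' where "r' = (\<lambda>v :: real^2. Complex (v $ 1) (v $ 2))"
  have rr: "r' (r z) = z" "r (r' v) = v" for z v
    by (simp_all add: r_def r'_def vec_eq_iff forall_2 axis_def)
  have ee: "\<exists>v. e v = x" for x
    by (rule exI [of _ "vector [fst x, snd x]"]) (simp add: e_def)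
  have e_inj: "e v = e w \<Longrightarrow> v = w" for v w by (simp add: e_def vec_eq_iff forall_2)
  have e_eq: "e = (\<lambda>v :: real^2. v $ 1 *\<^sub>R (1, 0) + v $ 2 *\<^sub>R (0, 1))" by (auto simp: e_def)
  have r'_eq: "r' = (\<lambda>v :: real^2. v $ 1 *\<^sub>R 1 + v $ 2 *\<^sub>R \<i>)" by (auto simp: r'_def complex_eq_iff)
  have de: "distr lborel borel e = lborel"
    unfolding e_eq by (rule lborel_distr_vec2) (auto simp: Basis_prod_def)
  have dr: "distr lborel borel r' = lborel"
    unfolding r'_eq by (rule lborel_distr_vec2) (auto simp: Basis_complex_def)
  have e_lin: "(e has_derivative e) (at v)" for v
    unfolding e_eq by (intro derivative_intros bounded_linear_imp_has_derivative bounded_linear_vec_nth)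
  have r_lin: "(r has_derivative r) (at z)" for z
    unfolding r_def by (auto intro!: derivative_eq_intros)
  have em: "e \<in> borel_measurable borel" and rm: "r' \<in> borel_measurable borel"
    unfolding e_eq r'_eq by (intro borel_measurable_continuous_onI continuous_intros)+
  define S' where "S' = e -` S"
  define h where "h = (\<lambda>v. r (g (e v)))"
  define h' where "h' = (\<lambda>v w. r (Dg (e v) (e w)))"
  have S': "S' \<in> sets borel"
    unfolding S'_def using measurable_sets [OF em S] by simp
  have hS: "h ` S' = r' -` (g ` S)"
  proof (intro equalityI subsetI)
    fix v assume "v \<in> r' -` (g ` S)"
    then obtain x where "x \<in> S" "r' v = g x" by auto
    moreover obtain w where "e w = x" using ee by blast
    ultimately have "v = h w" "w \<in> S'"
      using rr(2) [of v] by (auto simp: h_def S'_def)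
    then show "v \<in> h ` S'" by blast
  qed (auto simp: h_def S'_def rr)
  then have hS': "h ` S' \<in> sets borel" using measurable_sets [OF rm gS] by simp
  have h_inj: "inj_on h S'"
  proof (rule inj_onI)
    fix v w assume "v \<in> S'" "w \<in> S'" "h v = h w"
    then have "g (e v) = g (e w)" by (metis h_def rr(1))
    then show "v = w" using inj \<open>v \<in> S'\<close> \<open>w \<in> S'\<close> by (intro e_inj) (auto simp: S'_def dest: inj_onD)
  qed
  have h_der: "(h has_derivative h' v) (at v within S')" if "v \<in> S'" for v
  proof -
    have "(g \<circ> e has_derivative Dg (e v) \<circ> e) (at v)"
      using that by (intro diff_chain_at e_lin der) (simp add: S'_def)
    then have "(r \<circ> (g \<circ> e) has_derivative r \<circ> (Dg (e v) \<circ> e)) (at v)"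
      by (rule diff_chain_at [OF _ r_lin])
    then show ?thesis unfolding h_def h'_def o_def by (rule has_derivative_at_withinI)
  qed
  have det: "\<bar>det (matrix (h' v))\<bar> = J (e v)" if "v \<in> S'" for v
    using J [of "e v"] that
    by (simp add: det_2 matrix_def h'_def S'_def r_def e_def axis_def)
  have "set_integrable lborel (g ` S) f \<and> (LINT z:g ` S|lborel. f z) = b \<longleftrightarrow>
    set_integrable lborel (h ` S') (\<lambda>v. f (r' v)) \<and> (LINT v:h ` S'|lborel. f (r' v)) = b"
    unfolding hS by (rule set_lborel_distr [OF dr rm gS f])
  also have "\<dots> \<longleftrightarrow> (\<lambda>v. vec (f (r' v)) :: real^1) absolutely_integrable_on (h ` S')
      \<and> integral (h ` S') (\<lambda>v. vec (f (r' v)) :: real^1) = vec b"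
    by (rule set_lborel_iff_vec1 [OF hS']) (use f rm in measurable)
  also have "\<dots> \<longleftrightarrow> (\<lambda>v. \<bar>det (matrix (h' v))\<bar> *\<^sub>R vec (f (r' (h v))) :: real^1) absolutely_integrable_on S'
      \<and> integral S' (\<lambda>v. \<bar>det (matrix (h' v))\<bar> *\<^sub>R vec (f (r' (h v))) :: real^1) = vec b"
    by (rule has_absolute_integral_change_of_variables [symmetric, OF _ h_der h_inj])
       (use S' in auto)
  also have "\<dots> \<longleftrightarrow> (\<lambda>v. vec (J (e v) * f (g (e v))) :: real^1) absolutely_integrable_on S'
      \<and> integral S' (\<lambda>v. vec (J (e v) * f (g (e v))) :: real^1) = vec b"
  proof -
    have "\<bar>det (matrix (h' v))\<bar> *\<^sub>R vec (f (r' (h v))) = (vec (J (e v) * f (g (e v))) :: real^1)"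
      if "v \<in> S'" for v
      using det [OF that] by (simp add: h_def rr vec_eq_iff)
    then show ?thesis
      by (intro arg_cong2 [where f = "(\<and>)"] set_integrable_cong arg_cong2 [where f = "(=)"] integral_cong) auto
  qed
  also have "\<dots> \<longleftrightarrow> set_integrable lborel S' (\<lambda>v. J (e v) * f (g (e v)))
     \<and> (LINT v:S'|lborel. J (e v) * f (g (e v))) = b"
    by (rule set_lborel_iff_vec1 [OF S', symmetric]) (use measurable_compose [OF em m] in simp)
  also have "\<dots> \<longleftrightarrow> set_integrable lborel S (\<lambda>x. J x * f (g x)) \<and> (LINT x:S|lborel. J x * f (g x)) = b"
    unfolding S'_def by (rule set_lborel_distr [OF de em S m, symmetric])
  finally show ?thesis .
qed

section \<open>Jacobian and weight\<close>

lemma param_has_derivative: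
  "(param has_derivative (\<lambda>h.
      of_real (((- 2 * sin s * cos u - 2 * sin (2 * s)) * fst h - 2 * cos s * sin u * snd h) / 3)
      + \<i> * of_real (((2 * cos s * cos u - 2 * cos (2 * s)) * fst h - 2 * sin s * sin u * snd h) / 3)))
    (at (s, u))"
proof -
  have "param = (\<lambda>x. of_real ((2 * cos (fst x) * cos (snd x) + cos (2 * fst x)) / 3)
      + \<i> * of_real ((2 * sin (fst x) * cos (snd x) - sin (2 * fst x)) / 3))"
    by (auto simp: complex_eq_iff deltoid_param_Re deltoid_param_Im)
  then show ?thesis
    by (auto intro!: derivative_eq_intros simp: algebra_simps add_divide_distrib diff_divide_distrib)
qed

lemma continuous_on_half_discr: "continuous_on S (\<lambda>x. half_discr (fst x) (snd x))"
  unfolding half_discr_def by (intro continuous_intros)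

lemma deltoid_change_of_variables:
  fixes f :: "complex \<Rightarrow> real"
  assumes f: "f \<in> borel_measurable borel"
  shows "set_integrable lborel deltoid_domain f \<and> (LINT z:deltoid_domain|lborel. f z) = b \<longleftrightarrow>
    set_integrable lborel alcove (\<lambda>x. 4 / 9 * half_discr (fst x) (snd x) * f (param x))
    \<and> (LINT x:alcove|lborel. 4 / 9 * half_discr (fst x) (snd x) * f (param x)) = b"
  unfolding deltoid_domain_eq
proof (rule change_of_variables_2 [OF _ _ deltoid_param_inj])
  show "alcove \<in> sets borel" "param ` alcove \<in> sets borel"
    using open_alcove open_param_alcove by auto
  show "(param has_derivative (\<lambda>h.
      of_real (((- 2 * sin (fst x) * cos (snd x) - 2 * sin (2 * fst x)) * fst h - 2 * cos (fst x) * sin (snd x) * snd h) / 3)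
      + \<i> * of_real (((2 * cos (fst x) * cos (snd x) - 2 * cos (2 * fst x)) * fst h - 2 * sin (fst x) * sin (snd x) * snd h) / 3)))
    (at x)" (is "(_ has_derivative ?D x) _") for x
    using param_has_derivative [of "fst x" "snd x"] by simp
  show "\<bar>Re (?D x (1, 0)) * Im (?D x (0, 1)) - Re (?D x (0, 1)) * Im (?D x (1, 0))\<bar>
      = 4 / 9 * half_discr (fst x) (snd x)" if "x \<in> alcove" for x
  proof -
    obtain s u where x: "x = (s, u)" by fastforce
    \<comment> \<open>The determinant is 4/9 sin u times the difference of cos u and cos (s + 2 s),
      the latter appearing in expanded form.\<close>
    have "cos (3 * s) = cos (2 * s) * cos s - sin (2 * s) * sin s"
      using cos_add [of "2 * s" s] by simp
    moreover have "(sin s)\<^sup>2 + (cos s)\<^sup>2 = 1" by simp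
    ultimately have "(- 2 * sin s * cos u - 2 * sin (2 * s)) * (- 2 * sin s * sin u)
        - (- 2 * cos s * sin u) * (2 * cos s * cos u - 2 * cos (2 * s)) = 4 * half_discr s u"
      unfolding half_discr_def by algebra
    then have E: "Re (?D x (1, 0)) * Im (?D x (0, 1)) - Re (?D x (0, 1)) * Im (?D x (1, 0))
      = 4 / 9 * half_discr (fst x) (snd x)"
      unfolding x by (simp add: field_simps)
    show ?thesis unfolding E using half_discr_pos [of s u] that by (simp add: x abs_mult)
  qed
  have "param \<in> borel_measurable borel"
    by (intro borel_measurable_continuous_onI continuous_on_param)
  moreover have "(\<lambda>x. half_discr (fst x) (snd x)) \<in> borel_measurable borel"
    by (intro borel_measurable_continuous_onI continuous_on_half_discr)
  ultimately show "(\<lambda>x. 4 / 9 * half_discr (fst x) (snd x) * f (param x)) \<in> borel_measurable borel"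
    using f by measurable
qed (rule f)

lemma continuous_on_deltoid_P0: "continuous_on S deltoid_P0"
  unfolding deltoid_P0_def by (intro continuous_intros)

lemma half_discr_le: "half_discr s u \<le> 2"
proof -
  have "\<bar>half_discr s u\<bar> \<le> 1 * (1 + 1)"
    unfolding half_discr_def abs_mult
    by (intro mult_mono order_trans [OF abs_triangle_ineq4] add_mono) auto
  then show ?thesis by simp
qed

lemma emeasure_alcove_finite: "emeasure lborel alcove < \<infinity>"
proof -
  have "emeasure lborel alcove \<le> emeasure lborel closed_alcove"
    using borel_closed [OF compact_imp_closed [OF compact_closed_alcove]]
    by (intro emeasure_mono) (auto simp: alcove_def closed_alcove_def)
  also have "\<dots> < \<infinity>" by (rule emeasure_compact_finite [OF compact_closed_alcove])
  finally show ?thesis .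
qed

text \<open>The Jacobian contributes one factor h and P_0^\<alpha> contributes h^(2 \<alpha>); the
  exponents add up to 2 (lam - 1) / 3. This is nonnegative even where \<alpha> is negative, so the
  new weight is bounded on a triangle of finite measure.\<close>

lemma deltoid_weighted_integral:
  fixes g :: "complex \<Rightarrow> real"
  assumes lam: "lam \<ge> 1" and g: "continuous_on UNIV g"
  defines "\<alpha> \<equiv> deltoid_alpha lam"
  defines "F \<equiv> \<lambda>x. half_discr (fst x) (snd x) powr (2 * (lam - 1) / 3) * g (param x)"
  shows "set_integrable lborel alcove F"
    and "(LINT Z:deltoid_domain|lborel. deltoid_P0 Z powr \<alpha> * g Z)
      = 4 / 9 * (4 / 27) powr \<alpha> * (LINT x:alcove|lborel. F x)"
proof -
  have gm: "g \<in> borel_measurable borel" by (rule borel_measurable_continuous_onI [OF g])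
  have "compact ((\<lambda>x. g (param x)) ` closed_alcove)"
    by (intro compact_continuous_image compact_closed_alcove continuous_on_compose2 [OF g continuous_on_param]) auto
  then obtain B where B: "\<bar>g (param x)\<bar> \<le> B" if "x \<in> closed_alcove" for x
    by (metis bounded_real compact_imp_bounded imageI)
  have pm: "param \<in> borel_measurable borel"
    by (intro borel_measurable_continuous_onI continuous_on_param)
  have hm: "(\<lambda>x. half_discr (fst x) (snd x)) \<in> borel_measurable borel"
    by (intro borel_measurable_continuous_onI continuous_on_half_discr)
  show F: "set_integrable lborel alcove F"
    unfolding set_integrable_def
  proof (rule integrableI_bounded_set_indicator)
    show "alcove \<in> sets lborel" using open_alcove by auto
    show "F \<in> borel_measurable lborel"
      using gm pm hm unfolding F_def by simp
    show "AE x in lborel. x \<in> alcove \<longrightarrow> norm (F x) \<le> 2 powr (2 * (lam - 1) / 3) * B"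
    proof (intro AE_I2 impI)
      fix x assume x: "x \<in> alcove"
      then have "0 < half_discr (fst x) (snd x)" using half_discr_pos by (cases x) auto
      moreover have "x \<in> closed_alcove" using x by (auto simp: alcove_def closed_alcove_def)
      ultimately show "norm (F x) \<le> 2 powr (2 * (lam - 1) / 3) * B"
        unfolding F_def real_norm_def abs_mult using lam
        by (intro mult_mono B) (auto intro!: powr_mono2 half_discr_le)
    qed
  qed (rule emeasure_alcove_finite)
  let ?f = "\<lambda>Z. deltoid_P0 Z powr \<alpha> * g Z" and ?K = "4 / 9 * (4 / 27) powr \<alpha>"
  have fm: "?f \<in> borel_measurable borel"
    using gm borel_measurable_continuous_onI [OF continuous_on_deltoid_P0] by measurable
  have eq: "4 / 9 * half_discr (fst x) (snd x) * ?f (param x) = ?K * F x" if "x \<in> alcove" for x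
  proof -
    obtain s u where x: "x = (s, u)" by fastforce
    have h: "0 < half_discr s u" using half_discr_pos that x by simp
    have "1 + 2 * \<alpha> = 2 * (lam - 1) / 3" by (simp add: \<alpha>_def deltoid_alpha_def field_simps)
    then have hh: "half_discr s u * half_discr s u powr (2 * \<alpha>) = half_discr s u powr (2 * (lam - 1) / 3)"
      using h by (metis powr_add powr_one less_imp_le)
    have pw: "deltoid_P0 (param x) powr \<alpha> = (4 / 27) powr \<alpha> * half_discr s u powr (2 * \<alpha>)"
    proof -
      have "deltoid_P0 (param x) powr \<alpha> = (4 / 27) powr \<alpha> * (half_discr s u)\<^sup>2 powr \<alpha>"
        unfolding x prod.case deltoid_P0_param by (rule powr_mult)
      also have "(half_discr s u)\<^sup>2 powr \<alpha> = half_discr s u powr (2 * \<alpha>)"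
        using h by (simp add: powr_powr flip: powr_numeral)
      finally show ?thesis .
    qed
    have "4 / 9 * half_discr s u * (deltoid_P0 (param x) powr \<alpha> * y)
        = ?K * (half_discr s u powr (2 * (lam - 1) / 3) * y)" for y
      unfolding pw hh [symmetric] by (simp only: mult_ac)
    then show ?thesis by (simp only: x F_def fst_conv snd_conv)
  qed
  have "set_integrable lborel alcove (\<lambda>x. 4 / 9 * half_discr (fst x) (snd x) * ?f (param x))
    \<and> (LINT x:alcove|lborel. 4 / 9 * half_discr (fst x) (snd x) * ?f (param x)) = ?K * (LINT x:alcove|lborel. F x)"
  proof -
    have "set_integrable lborel alcove (\<lambda>x. ?K * F x)" using F by (rule set_integrable_mult_right)
    moreover have "(LINT x:alcove|lborel. ?K * F x) = ?K * (LINT x:alcove|lborel. F x)" by simp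
    moreover have "set_integrable lborel alcove (\<lambda>x. 4 / 9 * half_discr (fst x) (snd x) * ?f (param x))
        \<longleftrightarrow> set_integrable lborel alcove (\<lambda>x. ?K * F x)"
      by (intro set_integrable_cong refl eq)
    moreover have "(LINT x:alcove|lborel. 4 / 9 * half_discr (fst x) (snd x) * ?f (param x))
        = (LINT x:alcove|lborel. ?K * F x)"
      by (rule set_lebesgue_integral_cong) (use open_alcove eq in auto)
    ultimately show ?thesis by (simp only:)
  qed
  then show "(LINT Z:deltoid_domain|lborel. ?f Z) = ?K * (LINT x:alcove|lborel. F x)"
    using deltoid_change_of_variables [OF fm] by blast
qed

lemma sin_ge_half: "x / 2 \<le> sin x" if "0 \<le> x" "x \<le> pi / 3" for x :: real
proof -
  have "sin 0 - 0 / 2 \<le> sin x - x / 2"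
  proof (rule DERIV_nonneg_imp_nondecreasing [OF that(1)])
    fix y assume y: "0 \<le> y" "y \<le> x"
    have "cos (pi / 3) \<le> cos y" using y that by (intro cos_monotone_0_pi_le) auto
    then show "\<exists>d. ((\<lambda>x. sin x - x / 2) has_real_derivative d) (at y) \<and> 0 \<le> d"
      by (intro exI [of _ "cos y - 1 / 2"]) (auto intro!: derivative_eq_intros simp: cos_60)
  qed
  then show ?thesis by simp
qed

text \<open>The sine is symmetric about pi/2 and increases up to there, so on [t, pi - t] it is
  smallest at the end points.\<close>

lemma sin_ge_between:
  fixes t y :: real
  assumes "0 \<le> t" "t \<le> pi / 3" "t \<le> y" "y \<le> pi - t" shows "t / 2 \<le> sin y"
proof -
  have "sin t \<le> sin z" if "t \<le> z" "z \<le> pi / 2" for z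
    using that assms pi_gt_zero by (intro sin_monotone_2pi_le) linarith+
  from this [of y] this [of "pi - y"] have "sin t \<le> sin y"
    using assms by (cases "y \<le> pi / 2") auto
  with sin_ge_half [of t] assms show ?thesis by simp
qed

section \<open>The lower bound for the norm\<close>

lemma continuous_on_poly_space:
  assumes "P \<in> poly_space k" shows "continuous_on S P"
proof -
  from assms obtain c where "\<And>Z. P Z = (\<Sum>i\<le>k. \<Sum>j\<le>k - i. c i j * of_real (Re Z) ^ i * of_real (Im Z) ^ j)"
    unfolding poly_space_def by blast
  then have "P = (\<lambda>Z. \<Sum>i\<le>k. \<Sum>j\<le>k - i. c i j * of_real (Re Z) ^ i * of_real (Im Z) ^ j)" by blast
  then show ?thesis by (simp add: continuous_intros)
qed

lemma trig_poly_poly_space: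
  assumes P: "P \<in> poly_space k"
    and X: "trig_poly N (\<lambda>t. of_real (Re (\<gamma> t)))" and Y: "trig_poly N (\<lambda>t. of_real (Im (\<gamma> t)))"
  shows "trig_poly (N * k) (\<lambda>t. P (\<gamma> t))"
proof -
  from P obtain c where c: "\<And>Z. P Z = (\<Sum>i\<le>k. \<Sum>j\<le>k - i. c i j * of_real (Re Z) ^ i * of_real (Im Z) ^ j)"
    unfolding poly_space_def by blast
  have "trig_poly (N * k) (\<lambda>t. c i j * of_real (Re (\<gamma> t)) ^ i * of_real (Im (\<gamma> t)) ^ j)"
    if "i \<le> k" "j \<le> k - i" for i j
  proof (rule trig_poly_mono)
    show "trig_poly (0 + N * i + N * j) (\<lambda>t. c i j * of_real (Re (\<gamma> t)) ^ i * of_real (Im (\<gamma> t)) ^ j)"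
      by (intro trig_poly_mult trig_poly_power trig_poly_const X Y)
    have "N * (i + j) \<le> N * k" using that by (intro mult_le_mono2) simp
    then show "0 + N * i + N * j \<le> N * k" by (simp add: algebra_simps)
  qed
  then show ?thesis unfolding c by (intro trig_poly_sum) auto
qed

text \<open>In \<open>s\<close> the frequency 2 comes from the double angle; in \<open>u\<close> the
  frequencies are at most 1, and 2 is taken for uniformity.\<close>

lemma trig_poly_param_1: "trig_poly 2 (\<lambda>s. of_real (Re (deltoid_param s u)))"
    "trig_poly 2 (\<lambda>s. of_real (Im (deltoid_param s u)))"
  and trig_poly_param_2: "trig_poly 2 (\<lambda>u. of_real (Re (deltoid_param s u)))"
    "trig_poly 2 (\<lambda>u. of_real (Im (deltoid_param s u)))"
proof -
  note const = trig_poly_mono [OF trig_poly_const, of 2] trig_poly_mono [OF trig_poly_const, of 1]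
  have cos2: "trig_poly 2 (\<lambda>s. of_real (cos s))" and sin2: "trig_poly 2 (\<lambda>s. of_real (sin s))"
    using trig_poly_mono [OF trig_poly_cos, of 2] trig_poly_mono [OF trig_poly_sin, of 2] by auto
  have c0: "trig_poly N f \<Longrightarrow> trig_poly N (\<lambda>t. c * f t)" for N f c
    using trig_poly_mult [OF trig_poly_const, of N f c] by simp
  have cc: "trig_poly 2 (\<lambda>s. of_real (cos s) * of_real (cos s))"
    and sc: "trig_poly 2 (\<lambda>s. of_real (sin s) * of_real (cos s))"
    using trig_poly_mult [OF trig_poly_cos trig_poly_cos] trig_poly_mult [OF trig_poly_sin trig_poly_cos]
    by (simp_all add: numeral_2_eq_2)
  have "of_real (Re (deltoid_param s u)) = (2 / 3 * of_real (cos u)) * of_real (cos s)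
      + (2 / 3 * (of_real (cos s) * of_real (cos s)) + - 1 / 3 :: complex)" for s u
    by (simp add: deltoid_param_Re cos_double_cos add_divide_distrib diff_divide_distrib power2_eq_square)
  then show "trig_poly 2 (\<lambda>s. of_real (Re (deltoid_param s u)))"
    by (simp only:) (intro trig_poly_add c0 cos2 cc const, simp)
  have "of_real (Im (deltoid_param s u)) = (2 / 3 * of_real (cos u)) * of_real (sin s)
      + (- 2 / 3) * (of_real (sin s) * of_real (cos s) :: complex)" for s u
    by (simp add: deltoid_param_Im sin_double diff_divide_distrib) (simp add: mult_ac)
  then show "trig_poly 2 (\<lambda>s. of_real (Im (deltoid_param s u)))"
    by (simp only:) (intro trig_poly_add c0 sin2 sc)
  have "of_real (Re (deltoid_param s u)) = (2 / 3 * of_real (cos s)) * of_real (cos u)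
      + (of_real (cos (2 * s) / 3) :: complex)" for s u
    by (simp add: deltoid_param_Re add_divide_distrib)
  then show "trig_poly 2 (\<lambda>u. of_real (Re (deltoid_param s u)))"
    by (simp only:) (intro trig_poly_add c0 cos2 const, simp)
  have "of_real (Im (deltoid_param s u)) = (2 / 3 * of_real (sin s)) * of_real (cos u)
      + (of_real (- sin (2 * s) / 3) :: complex)" for s u
    by (simp add: deltoid_param_Im diff_divide_distrib)
  then show "trig_poly 2 (\<lambda>u. of_real (Im (deltoid_param s u)))"
    by (simp only:) (intro trig_poly_add c0 cos2 const, simp)
qed

text \<open>Change one coordinate at a time. Each restriction is a trigonometric polynomial of
  degree \<open>2 * k\<close>, which gives 14 = 7 * 2.\<close>

lemma poly_space_param_lipschitz:
  assumes P: "P \<in> poly_space k" and "k \<ge> 1" and M: "\<And>s u. cmod (P (deltoid_param s u)) \<le> M"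
  shows "cmod (P (deltoid_param s u) - P (deltoid_param s' u'))
    \<le> 14 * real k * M * (\<bar>s - s'\<bar> + \<bar>u - u'\<bar>)"
proof -
  have "cmod (P (deltoid_param s u) - P (deltoid_param s' u)) \<le> 7 * real (2 * k) * M * \<bar>s - s'\<bar>"
    using \<open>k \<ge> 1\<close> by (intro trig_poly_lipschitz [OF trig_poly_poly_space [OF P trig_poly_param_1]] M) simp
  moreover have "cmod (P (deltoid_param s' u) - P (deltoid_param s' u')) \<le> 7 * real (2 * k) * M * \<bar>u - u'\<bar>"
    using \<open>k \<ge> 1\<close> by (intro trig_poly_lipschitz [OF trig_poly_poly_space [OF P trig_poly_param_2]] M) simp
  ultimately have "cmod (P (deltoid_param s u) - P (deltoid_param s' u'))
      \<le> 7 * real (2 * k) * M * \<bar>s - s'\<bar> + 7 * real (2 * k) * M * \<bar>u - u'\<bar>"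
    by (rule norm_diff_triangle_le)
  then show ?thesis by (simp add: algebra_simps)
qed

text \<open>The box is the homothetic copy with ratio \<open>\<rho>\<close>, centred at the given point of the closed
  triangle, of a fixed box around the interior point $(\pi/3, \pi/3)$; the affine functions that
  cut out the triangle are therefore at least of order \<open>\<rho>\<close> on it.\<close>

lemma alcove_subbox:
  fixes \<rho> :: real
  assumes p: "(s', u') \<in> closed_alcove" and \<rho>: "0 < \<rho>" "\<rho> \<le> 1"
    and s: "\<bar>s - ((1 - \<rho>) * s' + \<rho> * (pi / 3))\<bar> \<le> \<rho> * (pi / 12)"
    and u: "\<bar>u - ((1 - \<rho>) * u' + \<rho> * (pi / 3))\<bar> \<le> \<rho> * (pi / 12)"
  shows "(s, u) \<in> alcove" "\<rho> ^ 3 / 32 \<le> half_discr s u" "\<bar>s - s'\<bar> + \<bar>u - u'\<bar> \<le> 8 * \<rho>"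
proof -
  \<comment> \<open>The preimage of the point under the homothety; it lies in the fixed box around
    (pi/3, pi/3).\<close>
  define a b where "a = (s - (1 - \<rho>) * s') / \<rho>" and "b = (u - (1 - \<rho>) * u') / \<rho>"
  have su: "s = (1 - \<rho>) * s' + \<rho> * a" "u = (1 - \<rho>) * u' + \<rho> * b"
    using \<rho> by (simp_all add: a_def b_def)
  have "s - ((1 - \<rho>) * s' + \<rho> * (pi / 3)) = \<rho> * (a - pi / 3)"
    "u - ((1 - \<rho>) * u' + \<rho> * (pi / 3)) = \<rho> * (b - pi / 3)"
    unfolding su by (simp_all add: right_diff_distrib)
  then have "\<rho> * \<bar>a - pi / 3\<bar> \<le> \<rho> * (pi / 12)" "\<rho> * \<bar>b - pi / 3\<bar> \<le> \<rho> * (pi / 12)"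
    using s u \<rho> by (simp_all only: abs_mult abs_of_pos)
  then have "\<bar>a - pi / 3\<bar> \<le> pi / 12" "\<bar>b - pi / 3\<bar> \<le> pi / 12"
    using \<rho> by (simp_all only: mult_le_cancel_left_pos)
  then have a: "pi / 4 \<le> a" "a \<le> 5 / 12 * pi" and b: "pi / 4 \<le> b" "b \<le> 5 / 12 * pi"
    by linarith+
  have p: "0 \<le> u'" "u' \<le> 3 * s'" "u' + 3 * s' \<le> 2 * pi" using p by (auto simp: closed_alcove_def)
  \<comment> \<open>Each of the three sine arguments is an affine function with values in [0, pi] on
    the closed triangle and in [pi/6, 5 pi/6] on the fixed box. The homothety forms convex
    combinations of such values.\<close>
  have conv: "\<rho> * (pi / 6) \<le> (1 - \<rho>) * x + \<rho> * y \<and> (1 - \<rho>) * x + \<rho> * y \<le> pi - \<rho> * (pi / 6)"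
    if "0 \<le> x" "x \<le> pi" "pi / 6 \<le> y" "y \<le> pi - pi / 6" for x y
  proof
    have "0 \<le> (1 - \<rho>) * x" "\<rho> * (pi / 6) \<le> \<rho> * y" using that \<rho> by auto
    then show "\<rho> * (pi / 6) \<le> (1 - \<rho>) * x + \<rho> * y" by linarith
    have "(1 - \<rho>) * x \<le> (1 - \<rho>) * pi" "\<rho> * y \<le> \<rho> * (pi - pi / 6)"
      using that \<rho> by (auto intro: mult_left_mono)
    then show "(1 - \<rho>) * x + \<rho> * y \<le> pi - \<rho> * (pi / 6)" by (simp add: algebra_simps)
  qed
  have pi: "3 < pi" "pi < 4" using pi_gt3 pi_less_4 by auto
  have lin: "(3 * s + u) / 2 = (1 - \<rho>) * ((3 * s' + u') / 2) + \<rho> * ((3 * a + b) / 2)"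
    "(3 * s - u) / 2 = (1 - \<rho>) * ((3 * s' - u') / 2) + \<rho> * ((3 * a - b) / 2)"
    unfolding su by (simp_all add: algebra_simps add_divide_distrib diff_divide_distrib)
  have r: "\<rho> * (pi / 6) \<le> u \<and> u \<le> pi - \<rho> * (pi / 6)"
    "\<rho> * (pi / 6) \<le> (3 * s + u) / 2 \<and> (3 * s + u) / 2 \<le> pi - \<rho> * (pi / 6)"
    "\<rho> * (pi / 6) \<le> (3 * s - u) / 2 \<and> (3 * s - u) / 2 \<le> pi - \<rho> * (pi / 6)"
  proof -
    show "\<rho> * (pi / 6) \<le> u \<and> u \<le> pi - \<rho> * (pi / 6)"
      unfolding su(2) by (rule conv) (use p b pi in linarith)+
    show "\<rho> * (pi / 6) \<le> (3 * s + u) / 2 \<and> (3 * s + u) / 2 \<le> pi - \<rho> * (pi / 6)"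
      unfolding lin by (rule conv) (use p a b pi in \<open>simp_all add: field_simps\<close>)
    show "\<rho> * (pi / 6) \<le> (3 * s - u) / 2 \<and> (3 * s - u) / 2 \<le> pi - \<rho> * (pi / 6)"
      unfolding lin by (rule conv) (use p a b pi in \<open>simp_all add: field_simps\<close>)
  qed
  have rp: "0 < \<rho> * (pi / 6)" using \<rho> by simp
  obtain d where d: "d = \<rho> * (pi / 6)" by blast
  have "0 < u" "u < 3 * s" "u + 3 * s < 2 * pi"
    using r [folded d] rp [folded d] by (simp_all add: field_simps)
  then show "(s, u) \<in> alcove" by (simp add: alcove_def)
  \<comment> \<open>Half of \<rho> pi/6 is at least \<rho>/4 because pi > 3. Three such sines and
    the factor 2 in \<open>half_discr_eq\<close> give \<rho>^3 / 32.\<close>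
  have "\<rho> / 4 \<le> sin y" if "\<rho> * (pi / 6) \<le> y \<and> y \<le> pi - \<rho> * (pi / 6)" for y
  proof -
    have "\<rho> * (pi / 6) \<le> pi / 3" using \<rho> mult_right_mono [of \<rho> 1 "pi / 6"] pi by simp
    then have "\<rho> * (pi / 6) / 2 \<le> sin y" using that rp by (intro sin_ge_between) auto
    moreover have "\<rho> * 3 \<le> \<rho> * pi" using \<rho> pi by (intro mult_left_mono) auto
    ultimately show ?thesis by simp
  qed
  note sines = this [OF r(1)] this [OF r(2)] this [OF r(3)]
  have "0 \<le> \<rho> / 4" using \<rho> by simp
  then have "(\<rho> / 4) * (\<rho> / 4) * (\<rho> / 4) \<le> sin u * sin ((3 * s + u) / 2) * sin ((3 * s - u) / 2)"
    by (intro mult_mono' sines mult_nonneg_nonneg)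
  then show "\<rho> ^ 3 / 32 \<le> half_discr s u"
    by (simp add: half_discr_eq power3_eq_cube)
  have "s - s' = \<rho> * (a - s')" "u - u' = \<rho> * (b - u')" unfolding su by (simp_all add: algebra_simps)
  then have "\<bar>s - s'\<bar> + \<bar>u - u'\<bar> = \<rho> * (\<bar>a - s'\<bar> + \<bar>b - u'\<bar>)"
    using \<rho>(1) by (simp only: abs_mult abs_of_pos distrib_left)
  also have "\<bar>a - s'\<bar> + \<bar>b - u'\<bar> \<le> 8"
    using p a b pi unfolding abs_le_iff abs_if by auto
  finally show "\<bar>s - s'\<bar> + \<bar>u - u'\<bar> \<le> 8 * \<rho>" using \<rho> by (simp add: mult.commute)
qed

lemma poly_space_lower_bound:
  fixes lam :: real
  assumes lam: "lam \<ge> 1"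
  defines "F \<equiv> \<lambda>(P :: complex \<Rightarrow> complex) x.
    half_discr (fst x) (snd x) powr (2 * (lam - 1) / 3) * (cmod (P (param x)))\<^sup>2"
  shows "\<exists>c>0. \<forall>k\<ge>1. \<forall>P\<in>poly_space k. \<forall>Z\<in>deltoid_domain.
    c * (cmod (P Z))\<^sup>2 \<le> real k powr (2 * lam) * (LINT x:alcove|lborel. F P x)"
proof -
  let ?\<gamma> = "2 * (lam - 1) / 3"
  \<comment> \<open>The lower bound for the weight and the area, both with their powers of
    \<open>k\<close> removed; 1/16 joins the square of 1/2 from \<open>M / 2\<close> with the 1/4 in
    the area bound.\<close>
  define c where "c = ((1 / 224) ^ 3 / 32) powr ?\<gamma> * (1 / 224)\<^sup>2 / 16"
  have "c > 0" by (simp add: c_def)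
  show ?thesis
  proof (intro exI [of _ c] conjI allI impI ballI \<open>c > 0\<close>)
    fix k :: nat and P Z assume k: "k \<ge> 1" and P: "P \<in> poly_space k" and Z: "Z \<in> deltoid_domain"
    \<comment> \<open>224 = 2 * 14 * 8 makes the Lipschitz bound
      \<open>14 * real k * M * (8 * \<rho>)\<close> equal to \<open>M / 2\<close>.\<close>
    define \<rho> where "\<rho> = 1 / (224 * real k)"
    have \<rho>: "0 < \<rho>" "\<rho> \<le> 1" using k by (auto simp: \<rho>_def field_simps)
    define f where "f s u = P (deltoid_param s u)" for s u
    have contP: "continuous_on S P" for S using P by (rule continuous_on_poly_space)
    have "(0, 0) \<in> closed_alcove" by (simp add: closed_alcove_def)
    then have "closed_alcove \<noteq> {}" by blast
    moreover have "continuous_on closed_alcove (\<lambda>x. cmod (P (param x)))"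
      by (intro continuous_on_norm continuous_on_compose2 [OF contP [of UNIV] continuous_on_param]) auto
    ultimately obtain p where p: "p \<in> closed_alcove"
      and max: "\<And>x. x \<in> closed_alcove \<Longrightarrow> cmod (P (param x)) \<le> cmod (P (param p))"
      using continuous_attains_sup [OF compact_closed_alcove] by blast
    obtain s' u' where su': "p = (s', u')" by fastforce
    define M where "M = cmod (f s' u')"
    have M: "cmod (P (deltoid_param s u)) \<le> M" for s u
      using deltoid_param_fold [of s u] max by (auto simp: su' M_def f_def)
    have M0: "0 \<le> M" by (simp add: M_def)
    have ZM: "cmod (P Z) \<le> M" using Z M by (auto simp: deltoid_domain_eq)
    define ms mu h where "ms = (1 - \<rho>) * s' + \<rho> * (pi / 3)" and "mu = (1 - \<rho>) * u' + \<rho> * (pi / 3)"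
      and "h = \<rho> * (pi / 12)"
    define Q where "Q = cbox (ms - h, mu - h) (ms + h, mu + h)"
    have Q: "x \<in> alcove \<and> (\<rho> ^ 3 / 32) powr ?\<gamma> * (M / 2)\<^sup>2 \<le> F P x" if "x \<in> Q" for x
    proof -
      obtain s u where x: "x = (s, u)" by fastforce
      have "\<bar>s - ms\<bar> \<le> h" "\<bar>u - mu\<bar> \<le> h"
        using that by (auto simp: x Q_def cbox_Pair_eq abs_le_iff)
      note box = alcove_subbox [OF p [unfolded su'] \<rho> this [unfolded ms_def mu_def h_def]]
      have "cmod (f s' u' - f s u) \<le> 14 * real k * M * (\<bar>s' - s\<bar> + \<bar>u' - u\<bar>)"
        unfolding f_def by (rule poly_space_param_lipschitz [OF P k M])
      also have "\<dots> \<le> 14 * real k * M * (8 * \<rho>)"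
        using box(3) M0 by (intro mult_left_mono) (auto simp: abs_minus_commute)
      also have "\<dots> = M / 2" using k by (simp add: \<rho>_def)
      finally have "M / 2 \<le> cmod (f s u)"
        using norm_triangle_ineq2 [of "f s' u'" "f s u"] unfolding M_def by linarith
      then have "(\<rho> ^ 3 / 32) powr ?\<gamma> * (M / 2)\<^sup>2 \<le> half_discr s u powr ?\<gamma> * (cmod (f s u))\<^sup>2"
        using lam \<rho> M0 box(2) by (intro mult_mono powr_mono2 power_mono) auto
      then show ?thesis using box(1) by (simp add: x F_def f_def)
    qed
    have "F P = (\<lambda>x. half_discr (fst x) (snd x) powr ?\<gamma> * (\<lambda>Z. (cmod (P Z))\<^sup>2) (param x))"
      by (simp add: F_def)
    then have F: "set_integrable lborel alcove (F P)"
      using deltoid_weighted_integral(1) [OF lam, of "\<lambda>Z. (cmod (P Z))\<^sup>2"] contP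
      by (simp add: continuous_intros)
    have "measure lborel Q = (2 * h) * (2 * h)"
      using \<rho> by (simp add: Q_def h_def content_Pair)
    \<comment> \<open>The side of the box is \<rho> pi/6, again compared by means of pi > 3.\<close>
    moreover have "\<rho> / 2 \<le> 2 * h"
      using mult_left_mono [of 3 pi \<rho>] pi_gt3 \<rho> by (simp add: h_def)
    then have "(\<rho> / 2) * (\<rho> / 2) \<le> (2 * h) * (2 * h)"
      using \<rho> by (intro mult_mono) auto
    ultimately have mQ: "\<rho>\<^sup>2 / 4 \<le> measure lborel Q"
      by (simp add: power2_eq_square)
    have "c * M\<^sup>2 = real k powr (2 * lam) * ((\<rho> ^ 3 / 32) powr ?\<gamma> * (M / 2)\<^sup>2 * (\<rho>\<^sup>2 / 4))"
    proof -
      have "\<rho> ^ 3 / 32 = (1 / 224) ^ 3 / 32 * real k powr (- 3)"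
        using k by (simp add: \<rho>_def power_divide power_mult_distrib powr_minus field_simps)
      moreover have "- 3 * ?\<gamma> = - 2 * (lam - 1)" by simp
      ultimately have "(\<rho> ^ 3 / 32) powr ?\<gamma> = ((1 / 224) ^ 3 / 32) powr ?\<gamma> * real k powr (- 2 * (lam - 1))"
        by (simp only: powr_mult powr_powr)
      moreover have "\<rho>\<^sup>2 = (1 / 224)\<^sup>2 * real k powr (- 2)"
        using k by (simp add: \<rho>_def power_divide power_mult_distrib powr_minus field_simps)
      \<comment> \<open>The weight costs k^(-2 (lam - 1)) and the area k^(-2); together they cancel
        k^(2 lam) exactly.\<close>
      moreover have "real k powr (2 * lam) * real k powr (- 2 * (lam - 1)) * real k powr (- 2) = 1"
      proof -
        have "2 * lam + - 2 * (lam - 1) + - 2 = 0" by simp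
        then show ?thesis using k by (simp only: powr_add [symmetric]) simp
      qed
      moreover have "y * ((a * x) * (M / 2)\<^sup>2 * ((b * z) / 4)) = a * b / 16 * M\<^sup>2 * (y * x * z)"
        for a b x y z :: real by (simp add: power_divide)
      ultimately show ?thesis by (simp only: c_def)
    qed
    also have "\<dots> \<le> real k powr (2 * lam) * (LINT x:alcove|lborel. F P x)"
    proof (rule mult_left_mono)
      let ?C = "(\<rho> ^ 3 / 32) powr ?\<gamma> * (M / 2)\<^sup>2"
      have "?C * (\<rho>\<^sup>2 / 4) \<le> ?C * measure lborel Q"
        using mQ by (intro mult_left_mono) auto
      also have "\<dots> = (LINT x|lborel. indicator Q x * ?C)"
        by (simp add: Q_def)
      also have "\<dots> \<le> (LINT x:alcove|lborel. F P x)"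
        unfolding set_lebesgue_integral_def
      proof (rule integral_mono)
        show "integrable lborel (\<lambda>x. indicator Q x * ?C)"
          by (intro integrable_mult_left integrable_real_indicator)
             (use emeasure_lborel_cbox_finite in \<open>auto simp: Q_def\<close>)
        show "integrable lborel (\<lambda>x. indicator alcove x *\<^sub>R F P x)"
          using F by (simp add: set_integrable_def)
        show "indicator Q x * ?C \<le> indicator alcove x *\<^sub>R F P x" for x
          using Q [of x] by (auto simp: indicator_def F_def)
      qed
      finally show "?C * (\<rho>\<^sup>2 / 4) \<le> (LINT x:alcove|lborel. F P x)" .
    qed simp
    finally have "c * M\<^sup>2 \<le> real k powr (2 * lam) * (LINT x:alcove|lborel. F P x)" .
    moreover have "c * (cmod (P Z))\<^sup>2 \<le> c * M\<^sup>2"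
      using ZM \<open>c > 0\<close> by (intro mult_left_mono power_mono) auto
    ultimately show "c * (cmod (P Z))\<^sup>2 \<le> real k powr (2 * lam) * (LINT x:alcove|lborel. F P x)" by linarith
  qed
qed

lemma deltoid_norm2_eq:
  assumes "continuous_on UNIV P"
  shows "deltoid_norm2 lam P = sqrt (deltoid_const lam *
    (LINT Z:deltoid_domain|lborel. deltoid_P0 Z powr deltoid_alpha lam * (cmod (P Z))\<^sup>2))"
proof -
  let ?w = "\<lambda>Z. deltoid_const lam * deltoid_P0 Z powr deltoid_alpha lam"
  have D: "deltoid_domain \<in> sets borel"
    unfolding deltoid_domain_eq using open_param_alcove by auto
  have w: "?w \<in> borel_measurable borel"
    using borel_measurable_continuous_onI [OF continuous_on_deltoid_P0] by measurable
  have P: "(\<lambda>Z. (cmod (P Z))\<^sup>2) \<in> borel_measurable borel"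
    by (intro borel_measurable_continuous_onI continuous_intros assms)
  \<comment> \<open>True whether or not the weight is integrable: the integral is nonnegative, being
    0 by convention in the other case, and 1 / 0 = 0.\<close>
  have "deltoid_const lam \<ge> 0"
    unfolding deltoid_const_def set_lebesgue_integral_def
    by (intro divide_nonneg_nonneg integral_nonneg_AE) auto
  then have "(LINT Z|deltoid_measure lam. (cmod (P Z))\<^sup>2)
      = (LINT Z|restrict_space lborel deltoid_domain. ?w Z *\<^sub>R (cmod (P Z))\<^sup>2)"
    unfolding deltoid_measure_def
    by (intro integral_density measurable_restrict_space1) (use w P in auto)
  also have "\<dots> = (LINT Z|lborel. indicator deltoid_domain Z *\<^sub>R (?w Z *\<^sub>R (cmod (P Z))\<^sup>2))"
    by (rule integral_restrict_space) (use D in simp)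
  also have "\<dots> = deltoid_const lam *
      (LINT Z:deltoid_domain|lborel. deltoid_P0 Z powr deltoid_alpha lam * (cmod (P Z))\<^sup>2)"
    unfolding set_lebesgue_integral_def
    by (subst integral_mult_right_zero [symmetric]) (simp add: mult_ac)
  finally show ?thesis by (simp add: deltoid_norm2_def)
qed

theorem proposition5p3:
  fixes lam :: real
  assumes "lam \<ge> 1"
  shows "\<exists>C1 :: real. \<forall>k \<ge> 1. \<forall>P \<in> deltoid_H lam k.
    deltoid_norm_sup P \<le> ereal (C1 * real k powr (lam + 1 / 2) * deltoid_norm2 lam P)"
proof -
  let ?F = "\<lambda>(P :: complex \<Rightarrow> complex) x.
    half_discr (fst x) (snd x) powr (2 * (lam - 1) / 3) * (cmod (P (param x)))\<^sup>2"
  define K where "K = 4 / 9 * (4 / 27) powr deltoid_alpha lam"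
  have K: "K > 0" by (simp add: K_def)
  obtain c where c: "c > 0"
    and lower: "\<And>k P Z. k \<ge> 1 \<Longrightarrow> P \<in> poly_space k \<Longrightarrow> Z \<in> deltoid_domain \<Longrightarrow>
      c * (cmod (P Z))\<^sup>2 \<le> real k powr (2 * lam) * (LINT x:alcove|lborel. ?F P x)"
    using poly_space_lower_bound [OF assms] by blast
  have weighted: "(LINT Z:deltoid_domain|lborel. deltoid_P0 Z powr deltoid_alpha lam * (cmod (P Z))\<^sup>2)
      = K * (LINT x:alcove|lborel. ?F P x)" if "continuous_on UNIV P" for P :: "complex \<Rightarrow> complex"
    unfolding K_def
    by (rule deltoid_weighted_integral(2) [OF assms]) (intro continuous_intros that)
  \<comment> \<open>The constant would be 1 / 0 = 0 if the weight had integral zero. The lower bound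
    for the polynomial 1 with \<open>k = 1\<close> excludes this.\<close>
  have const_pos: "deltoid_const lam > 0"
  proof -
    let ?one = "\<lambda>_ :: complex. 1 :: complex"
    have "?one \<in> poly_space 1"
      unfolding poly_space_def
      by (intro CollectI exI [of _ "\<lambda>i j. if i = 0 \<and> j = 0 then 1 else 0"] allI) (simp add: numeral_eq_Suc)
    moreover have "param (pi / 3, pi / 3) \<in> deltoid_domain"
      unfolding deltoid_domain_eq by (rule imageI) (simp add: alcove_def)
    ultimately have "c * 1 \<le> (LINT x:alcove|lborel. ?F ?one x)"
      using lower [of 1 ?one "param (pi / 3, pi / 3)"] by simp
    then show ?thesis
      using weighted [of ?one] c K by (simp add: deltoid_const_def)
  qed
  show ?thesis
  proof (intro exI allI impI ballI)
    fix k :: nat and P assume k: "1 \<le> k" and "P \<in> deltoid_H lam k"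
    then have P: "P \<in> poly_space k" by (simp add: deltoid_H_def)
    have norm2: "deltoid_norm2 lam P = sqrt (deltoid_const lam * K * (LINT x:alcove|lborel. ?F P x))"
      using deltoid_norm2_eq weighted continuous_on_poly_space [OF P] by (simp add: mult.assoc)
    have "cmod (P Z) \<le> sqrt (1 / (c * deltoid_const lam * K)) * real k powr (lam + 1 / 2) * deltoid_norm2 lam P"
      if Z: "Z \<in> deltoid_domain" for Z
    proof -
      have "(cmod (P Z))\<^sup>2 \<le> real k powr (2 * lam) * (LINT x:alcove|lborel. ?F P x) / c"
        using lower [OF k P Z] c by (simp add: field_simps)
      then have "cmod (P Z) \<le> sqrt (real k powr (2 * lam) * (LINT x:alcove|lborel. ?F P x) / c)"
        by (rule real_le_rsqrt)
      also have "\<dots> = sqrt (1 / (c * deltoid_const lam * K)) * real k powr lam * deltoid_norm2 lam P"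
      proof -
        have "sqrt (real k powr (2 * lam)) = real k powr lam"
          using k by (simp add: powr_half_sqrt [symmetric] powr_powr)
        then show ?thesis
          unfolding norm2 using c K const_pos by (simp add: real_sqrt_mult real_sqrt_divide field_simps)
      qed
      \<comment> \<open>Since \<open>k\<close> is at least 1, the exponent \<open>lam\<close> may be
        raised by 1/2.\<close>
      also have "\<dots> \<le> sqrt (1 / (c * deltoid_const lam * K)) * real k powr (lam + 1 / 2) * deltoid_norm2 lam P"
        using k c K const_pos
        by (intro mult_right_mono mult_left_mono powr_mono) (auto simp: deltoid_norm2_def)
      finally show ?thesis .
    qed
    then show "deltoid_norm_sup P \<le> ereal (sqrt (1 / (c * deltoid_const lam * K)) * real k powr (lam + 1 / 2) * deltoid_norm2 lam P)"
      unfolding deltoid_norm_sup_def by (intro SUP_least) simp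
  qed
qed

end
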